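(* Let $\rho_1,\rho_2$ be two finite convex expectations defined on $L^1(\mu)$. Let $K_1,K_2\in L^1(\mu)$ with $0\le K_1<K_2$, and consider the problem of minimizing $\rho_2(K_2-X)$ over $$\mathcal{X}_\alpha=\{X\in L^1(\mu):K_1\le X\le K_2,\ \rho_1(X)\le\alpha\}.$$ Then an optimal test exists, i.e. there is $X^*\in\mathcal{X}_\alpha$ with $\rho_2(K_2-X^* )=\inf_{X\in\mathcal{X}_\alpha}\rho_2(K_2-X)$. Moreover, there exist $P^*\in\mathcal{P}$ and $Q^*\in\mathcal{Q}$ such that every optimal test $X^*$ can be expressed as $$X^*=K_2I_{\{H_{Q^*}>zG_{P^*}\}}+B\,I_{\{H_{Q^*}=zG_{P^*}\}}+K_1I_{\{H_{Q^*}<zG_{P^*}\}},\quad \mu\text{-a.e.},$$ for some $z\in[0,+\infty)\cup\{+\infty\}$ and some random variable $B$ taking values in the random interval $[K_1,K_2]$.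
   Context: $(\Omega,\mathcal{F},\mu)$ is a probability space and $\mathcal{M}$ is the set of probability measures on $(\Omega,\mathcal{F})$ absolutely continuous with respect to $\mu$. For $P,Q\in\mathcal{M}$ write $G_P=\frac{dP}{d\mu}$ and $H_Q=\frac{dQ}{d\mu}$. $I_A$ is the indicator function of $A$. A (finite) convex expectation on $L^1(\mu)$ is a map $\rho:L^1(\mu)\to\mathbb{R}$ such that for all $X,Y\in L^1(\mu)$: (i) $X\ge Y$ implies $\rho(X)\ge\rho(Y)$; (ii) $\rho(X+c)=\rho(X)+c$ for every constant $c$; (iii) $\rho(\lambda X+(1-\lambda)Y)\le\lambda\rho(X)+(1-\lambda)\rho(Y)$ for $\lambda\in[0,1]$. For $P\in\mathcal{M}$ with $\frac{dP}{d\mu}\in L^\infty(\mu)$ let $\rho_i^*(P)=\sup_{X\in L^1(\mu)}(E_P[X]-\rho_i(X))$, $i=1,2$. Then $\mathcal{P}$ (resp. $\mathcal{Q}$) is the set of $P\in\mathcal{M}$ with $\frac{dP}{d\mu}\in L^\infty(\mu)$ and $\rho_1^*(P)<\infty$ (resp. $\rho_2^*(P)<\infty$). $\alpha$ is a fixed real number (significance level) with $\rho_1(K_1)\le\alpha\le\rho_1(K_2)$; inequalities between random variables hold $\mu$-a.e. When $z=+\infty$, the comparison of $H_{Q^*}$ with $zG_{P^*}$ is understood as the comparison of $\frac1z H_{Q^*}=0$ with $G_{P^*}$: $\{H_{Q^*}>zG_{P^*}\}=\emptyset$, $\{H_{Q^*}=zG_{P^*}\}=\{G_{P^*}=0\}$,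 $\{H_{Q^*}<zG_{P^*}\}=\{G_{P^*}>0\}$. *)

theory Defs
  imports "HOL-Probability.Probability"
begin

text \<open>
  Elements of \<open>L\<^sup>1(\<mu>)\<close> are represented by integrable functions, with all relations between them
  holding almost everywhere. In particular, monotonicity is required for the a.e. order, so that
  \<open>\<rho>\<close> takes equal values on a.e. equal functions and hence is a map on \<open>L\<^sup>1(\<mu>)\<close>; its values on
  non-integrable functions are irrelevant.
\<close>

definition convex_expectation :: "'a measure \<Rightarrow> (('a \<Rightarrow> real) \<Rightarrow> real) \<Rightarrow> bool" where
  "convex_expectation M \<rho> \<longleftrightarrow>
     (\<forall>X Y. integrable M X \<longrightarrow> integrable M Y \<longrightarrow> (AE \<omega> in M. Y \<omega> \<le> X \<omega>) \<longrightarrow> \<rho> Y \<le> \<rho> X) \<and>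
     (\<forall>X c. integrable M X \<longrightarrow> \<rho> (\<lambda>\<omega>. X \<omega> + c) = \<rho> X + c) \<and>
     (\<forall>X Y. \<forall>l\<in>{0..1}. integrable M X \<longrightarrow> integrable M Y \<longrightarrow>
        \<rho> (\<lambda>\<omega>. l * X \<omega> + (1 - l) * Y \<omega>) \<le> l * \<rho> X + (1 - l) * \<rho> Y)"

definition ac_probs :: "'a measure \<Rightarrow> 'a measure set" where
  "ac_probs M = {P. sets P = sets M \<and> prob_space P \<and> absolutely_continuous M P}"

definition bounded_density :: "'a measure \<Rightarrow> 'a measure \<Rightarrow> bool" where
  "bounded_density M P \<longleftrightarrow> (\<exists>C::real. AE \<omega> in M. RN_deriv M P \<omega> \<le> ennreal C)"

definition penalty :: "'a measure \<Rightarrow> (('a \<Rightarrow> real) \<Rightarrow> real) \<Rightarrow> 'a measure \<Rightarrow> ereal" where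
  "penalty M \<rho> P = (SUP X\<in>{X. integrable M X}. ereal (integral\<^sup>L P X - \<rho> X))"

definition finite_penalty_probs :: "'a measure \<Rightarrow> (('a \<Rightarrow> real) \<Rightarrow> real) \<Rightarrow> 'a measure set" where
  "finite_penalty_probs M \<rho> = {P \<in> ac_probs M. bounded_density M P \<and> penalty M \<rho> P < \<infinity>}"

definition tests ::
  "'a measure \<Rightarrow> (('a \<Rightarrow> real) \<Rightarrow> real) \<Rightarrow> ('a \<Rightarrow> real) \<Rightarrow> ('a \<Rightarrow> real) \<Rightarrow> real \<Rightarrow> ('a \<Rightarrow> real) set" where
  "tests M \<rho>\<^sub>1 K\<^sub>1 K\<^sub>2 \<alpha> =
     {X. integrable M X \<and> (AE \<omega> in M. K\<^sub>1 \<omega> \<le> X \<omega> \<and> X \<omega> \<le> K\<^sub>2 \<omega>) \<and> \<rho>\<^sub>1 X \<le> \<alpha>}"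

definition optimal_test ::
  "'a measure \<Rightarrow> (('a \<Rightarrow> real) \<Rightarrow> real) \<Rightarrow> (('a \<Rightarrow> real) \<Rightarrow> real) \<Rightarrow> ('a \<Rightarrow> real) \<Rightarrow> ('a \<Rightarrow> real) \<Rightarrow> real \<Rightarrow>
   ('a \<Rightarrow> real) \<Rightarrow> bool" where
  "optimal_test M \<rho>\<^sub>1 \<rho>\<^sub>2 K\<^sub>1 K\<^sub>2 \<alpha> X \<longleftrightarrow>
     X \<in> tests M \<rho>\<^sub>1 K\<^sub>1 K\<^sub>2 \<alpha> \<and>
     ereal (\<rho>\<^sub>2 (\<lambda>\<omega>. K\<^sub>2 \<omega> - X \<omega>)) = (INF Y\<in>tests M \<rho>\<^sub>1 K\<^sub>1 K\<^sub>2 \<alpha>. ereal (\<rho>\<^sub>2 (\<lambda>\<omega>. K\<^sub>2 \<omega> - Y \<omega>)))"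

text \<open>
  The three regions comparing \<open>H = dQ/d\<mu>\<close> with \<open>z G\<close>, where \<open>G = dP/d\<mu>\<close>. For \<open>z = \<infinity>\<close> the
  comparison is that of \<open>H / z = 0\<close> with \<open>G\<close>; this is not what \<open>\<infinity> * 0 = 0\<close> in
  \<^typ>\<open>ennreal\<close> would give, hence the case distinction.
\<close>

definition density_above :: "'a measure \<Rightarrow> 'a measure \<Rightarrow> 'a measure \<Rightarrow> ennreal \<Rightarrow> 'a set" where
  "density_above M Q P z =
     (if z = \<infinity> then {} else {\<omega> \<in> space M. RN_deriv M Q \<omega> > z * RN_deriv M P \<omega>})"

definition density_equal :: "'a measure \<Rightarrow> 'a measure \<Rightarrow> 'a measure \<Rightarrow> ennreal \<Rightarrow> 'a set" where
  "density_equal M Q P z =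
     (if z = \<infinity> then {\<omega> \<in> space M. RN_deriv M P \<omega> = 0}
      else {\<omega> \<in> space M. RN_deriv M Q \<omega> = z * RN_deriv M P \<omega>})"

definition density_below :: "'a measure \<Rightarrow> 'a measure \<Rightarrow> 'a measure \<Rightarrow> ennreal \<Rightarrow> 'a set" where
  "density_below M Q P z =
     (if z = \<infinity> then {\<omega> \<in> space M. RN_deriv M P \<omega> > 0}
      else {\<omega> \<in> space M. RN_deriv M Q \<omega> < z * RN_deriv M P \<omega>})"

end

theory Submission
  imports Defs "HOL-Library.Function_Algebras"
begin

text \<open>
  The problem is convex, and an optimal test is a minimizer of a linear functional over the order
  interval between \<open>K\<^sub>1\<close> and \<open>K\<^sub>2\<close>. This functional is integration against \<open>\<theta> = a * G - b * H\<close>, where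
  \<open>G\<close> and \<open>H\<close> are the densities of \<open>P\<close> and \<open>Q\<close>, and \<open>a\<close> and \<open>b\<close> are Lagrange multipliers. Its minimizers
  equal \<open>K\<^sub>2\<close> where \<open>\<theta> < 0\<close> and \<open>K\<^sub>1\<close> where \<open>\<theta> > 0\<close>; with \<open>z = a / b\<close> this is the asserted form.

  The linearization rests on subgradients. A linear minorant of the increments of a convex expectation
  is positive and normalized. On \<open>L\<^sup>1\<close> a positive linear functional is automatically bounded, so it is
  integration against a probability measure with bounded density, and this measure has finite
  penalty (\<open>minorant_eq_integral\<close>). The Hahn-Banach theorem provides such minorants.

  Existence of an optimal test: convex expectations are lower semicontinuous along dominated sequences,
  because of their subgradients. The sets of near-optimal tests are nested and convex, and elements of
  nearly minimal weighted \<open>L\<^sup>2\<close> norm converge to a common point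
  (\<open>nested_convex_sets_nonempty\<close>).

  The form of the optimal tests: by separation in the plane there are multipliers \<open>a, b \<ge> 0\<close>, not both
  zero, such that \<open>a * (\<rho>\<^sub>1 X - \<alpha>) + b * (\<rho>\<^sub>2 (K\<^sub>2 - X) - v)\<close> is nonnegative on the order interval,
  where \<open>v\<close> is the optimal value (\<open>convex_fritz_john\<close>). It vanishes at each optimal test. At one
  optimal test \<open>X\<^sub>0\<close>, the Hahn-Banach theorem on \<open>L\<^sup>1 \<times> L\<^sup>1\<close> gives subgradients \<open>P\<close> and \<open>Q\<close> whose
  combination is minimized at \<open>X\<^sub>0\<close> over the order interval (\<open>joint_subgradients\<close>). The same \<open>P\<close> and \<open>Q\<close>
  serve for every other optimal test \<open>X\<close>: the linearized cost lies below the convex cost, which is the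
  same at \<open>X\<close> as at \<open>X\<^sub>0\<close>, so \<open>X\<close> minimizes the linearized cost too.
\<close>

section \<open>The Hahn-Banach theorem\<close>

text \<open>
  Integrable functions on a measure space are a linear subspace of the space of all functions, and
  pairs of them a subspace of a product. With the pointwise structure on functions, one Hahn-Banach
  theorem over \<^class>\<open>real_vector\<close> serves both.
\<close>

instantiation "fun" :: (type, real_vector) real_vector
begin

definition scaleR_fun_def: "c *\<^sub>R f = (\<lambda>x. c *\<^sub>R f x)"

instance
  by standard (auto simp: scaleR_fun_def fun_eq_iff algebra_simps)

end

lemma scaleR_fun_apply [simp]: "(c *\<^sub>R f) x = c *\<^sub>R f x"
  by (simp add: scaleR_fun_def)

definition sublinear :: "('v::real_vector \<Rightarrow> real) \<Rightarrow> bool" where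
  "sublinear p \<longleftrightarrow>
     (\<forall>x y. p (x + y) \<le> p x + p y) \<and> (\<forall>c\<ge>0. \<forall>x. p (c *\<^sub>R x) = c * p x)"

lemma sublinear_add: "sublinear p \<Longrightarrow> p (x + y) \<le> p x + p y"
  and sublinear_scaleR: "sublinear p \<Longrightarrow> 0 \<le> c \<Longrightarrow> p (c *\<^sub>R x) = c * p x"
  by (auto simp: sublinear_def)

lemma sublinear_zero: "sublinear p \<Longrightarrow> p 0 = 0"
  using sublinear_scaleR[of p 0 0] by simp

lemma sublinear_uminus: "sublinear p \<Longrightarrow> - p (- x) \<le> p x"
  using sublinear_add[of p x "- x"] by (simp add: sublinear_zero)

lemma sublinearI:
  assumes "\<And>x y. p (x + y) \<le> p x + p y" "\<And>c x. 0 < c \<Longrightarrow> p (c *\<^sub>R x) \<le> c * p x" "p 0 = 0"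
  shows "sublinear p"
proof -
  have "p (c *\<^sub>R x) = c * p x" if "0 \<le> c" for c x
  proof (cases "c = 0")
    case False
    with that have c: "0 < c" by simp
    have "p x \<le> inverse c * p (c *\<^sub>R x)"
      using assms(2)[of "inverse c" "c *\<^sub>R x"] c by simp
    then have "c * p x \<le> p (c *\<^sub>R x)"
      using c by (simp add: field_simps)
    with assms(2)[OF c, of x] show ?thesis by simp
  qed (use assms(3) in simp)
  with assms(1) show ?thesis by (auto simp: sublinear_def)
qed

text \<open>
  If \<open>q\<close> is minimal, it cannot be lowered in the direction of \<open>x\<close>: the functional \<open>r\<close> below
  is what \<open>q\<close> becomes when its value at \<open>- x\<close> is pushed down to \<open>- q x\<close>, and \<open>r\<close> is still
  sublinear. So \<open>r = q\<close>, which says that \<open>q\<close> is odd; a sublinear odd functional is linear.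
\<close>

lemma minimal_sublinear_imp_linear:
  assumes q: "sublinear q" and min: "\<And>r. sublinear r \<Longrightarrow> r \<le> q \<Longrightarrow> r = q"
  shows "linear q"
proof -
  have neg: "q (- x) = - q x" for x
  proof -
    define r where "r w = (INF t\<in>{0..}. q (w + t *\<^sub>R x) - t * q x)" for w
    have low: "- q (- w) \<le> q (w + t *\<^sub>R x) - t * q x" if "0 \<le> t" for w t
      using sublinear_add[OF q, of "w + t *\<^sub>R x" "- w"] sublinear_scaleR[OF q that, of x] by simp
    then have bdd: "bdd_below ((\<lambda>t. q (w + t *\<^sub>R x) - t * q x) ` {0..})" for w
      by (intro bdd_belowI2) auto
    have r_le: "r w \<le> q (w + t *\<^sub>R x) - t * q x" if "0 \<le> t" for w t
      unfolding r_def using that by (intro cINF_lower bdd) auto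
    have r_ge: "b \<le> r w" if "\<And>t. 0 \<le> t \<Longrightarrow> b \<le> q (w + t *\<^sub>R x) - t * q x" for b w
      unfolding r_def using that by (intro cINF_greatest) auto
    have "sublinear r"
    proof (rule sublinearI)
      fix u v
      have *: "r (u + v) \<le> (q (u + s *\<^sub>R x) - s * q x) + (q (v + t *\<^sub>R x) - t * q x)"
        if "0 \<le> s" "0 \<le> t" for s t
        using r_le[of "s + t" "u + v"] sublinear_add[OF q, of "u + s *\<^sub>R x" "v + t *\<^sub>R x"] that
        by (simp add: algebra_simps)
      have "r (u + v) - (q (v + t *\<^sub>R x) - t * q x) \<le> r u" if "0 \<le> t" for t
        using *[OF _ that] by (intro r_ge) (simp add: algebra_simps)
      then have "r (u + v) - r u \<le> r v"
        by (intro r_ge) (force simp: algebra_simps)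
      then show "r (u + v) \<le> r u + r v" by simp
    next
      fix c :: real and w assume c: "0 < c"
      have "r (c *\<^sub>R w) / c \<le> r w"
      proof (rule r_ge)
        fix t :: real assume "0 \<le> t"
        then show "r (c *\<^sub>R w) / c \<le> q (w + t *\<^sub>R x) - t * q x"
          using r_le[of "c * t" "c *\<^sub>R w"] sublinear_scaleR[OF q, of c "w + t *\<^sub>R x"] c
          by (simp add: field_simps scaleR_add_right)
      qed
      then show "r (c *\<^sub>R w) \<le> c * r w" using c by (simp add: field_simps)
    next
      show "r 0 = 0"
        using r_le[of 0 0] r_ge[of 0 0] sublinear_scaleR[OF q, of _ x] sublinear_zero[OF q]
        by fastforce
    qed
    moreover have "r \<le> q"
      using r_le[of 0] by (auto simp: le_fun_def)
    ultimately have "r = q" by (rule min)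
    then show ?thesis
      using r_le[of 1 "- x"] sublinear_uminus[OF q, of x] sublinear_zero[OF q] by simp
  qed
  show ?thesis
  proof
    fix x y
    show "q (x + y) = q x + q y"
      using sublinear_add[OF q, of x y] sublinear_add[OF q, of "- x" "- y"] neg[of "x + y"]
        neg[of x] neg[of y] by simp
  next
    fix c :: real and x
    show "q (c *\<^sub>R x) = c *\<^sub>R q x"
    proof (cases "0 \<le> c")
      case False
      then show ?thesis
        using sublinear_scaleR[OF q, of "- c" x] neg[of "c *\<^sub>R x"] by simp
    qed (simp add: sublinear_scaleR[OF q])
  qed
qed

lemma sublinear_INF_chain:
  assumes C: "C \<noteq> {}" "\<And>q. q \<in> C \<Longrightarrow> sublinear q" "\<And>q. q \<in> C \<Longrightarrow> q \<le> p"
    and chain: "\<And>q r. q \<in> C \<Longrightarrow> r \<in> C \<Longrightarrow> q \<le> r \<or> r \<le> q"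
  defines "u \<equiv> \<lambda>x. INF q\<in>C. q x"
  shows "sublinear u" and "\<And>q. q \<in> C \<Longrightarrow> u \<le> q"
proof -
  have "- p (- x) \<le> q x" if "q \<in> C" for q x
    using sublinear_uminus[OF C(2)[OF that], of x] C(3)[OF that] by (force simp: le_fun_def dest: spec[of _ "- x"])
  then have bdd: "bdd_below ((\<lambda>q. q x) ` C)" for x
    by (intro bdd_belowI2)
  have u_le: "u x \<le> q x" if "q \<in> C" for q x
    unfolding u_def using that by (intro cINF_lower bdd)
  then show "u \<le> q" if "q \<in> C" for q
    using that by (auto simp: le_fun_def)
  have u_ge: "b \<le> u x" if "\<And>q. q \<in> C \<Longrightarrow> b \<le> q x" for b x
    unfolding u_def using that C(1) by (intro cINF_greatest) auto
  show "sublinear u"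
  proof (rule sublinearI)
    fix x y
    have *: "u (x + y) \<le> q x + r y" if qr: "q \<in> C" "r \<in> C" for q r
      using chain[OF qr]
    proof
      assume "q \<le> r"
      then show ?thesis
        using u_le[OF qr(1), of "x + y"] sublinear_add[OF C(2)[OF qr(1)], of x y]
        by (force simp: le_fun_def dest: spec[of _ y])
    next
      assume "r \<le> q"
      then show ?thesis
        using u_le[OF qr(2), of "x + y"] sublinear_add[OF C(2)[OF qr(2)], of x y]
        by (force simp: le_fun_def dest: spec[of _ x])
    qed
    have "u (x + y) - r y \<le> u x" if "r \<in> C" for r
      using *[OF _ that] by (intro u_ge) (simp add: algebra_simps)
    then have "u (x + y) - u x \<le> u y"
      by (intro u_ge) (force simp: algebra_simps)
    then show "u (x + y) \<le> u x + u y" by simp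
  next
    fix c :: real and x assume c: "0 < c"
    have "u (c *\<^sub>R x) / c \<le> u x"
    proof (rule u_ge)
      fix q assume "q \<in> C"
      then show "u (c *\<^sub>R x) / c \<le> q x"
        using u_le[of q "c *\<^sub>R x"] sublinear_scaleR[OF C(2), of q c x] c by (simp add: field_simps)
    qed
    then show "u (c *\<^sub>R x) \<le> c * u x" using c by (simp add: field_simps)
  next
    show "u 0 = 0"
      using C(1) unfolding u_def by (simp add: sublinear_zero[OF C(2)] cong: INF_cong_simp)
  qed
qed

text \<open>
  Minimality replaces the usual extension of functionals from subspaces: Zorn's lemma is
  applied to the sublinear functionals below \<open>p\<close>, so that every object is defined on the whole
  space.
\<close>

proposition hahn_banach_sublinear:
  assumes p: "sublinear p"
  shows "\<exists>f. linear f \<and> (\<forall>x. f x \<le> p x)"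
proof -
  let ?A = "{q. sublinear q \<and> q \<le> p}"
  have "\<exists>m\<in>?A. \<forall>a\<in>?A. m \<ge> a \<longrightarrow> a = m"
  proof (rule predicate_Zorn)
    show "partial_order_on ?A (relation_of (\<ge>) ?A)"
      by (rule partial_order_on_relation_ofI) auto
  next
    fix C assume C: "C \<in> Chains (relation_of (\<ge>) ?A)"
    show "\<exists>u\<in>?A. \<forall>a\<in>C. u \<le> a"
    proof (cases "C = {}")
      case True
      with p show ?thesis by auto
    next
      case False
      have A: "sublinear q" "q \<le> p" if "q \<in> C" for q
        using C that by (auto simp: Chains_def relation_of_def)
      have ch: "q \<le> r \<or> r \<le> q" if "q \<in> C" "r \<in> C" for q r
        using C that by (auto simp: Chains_def relation_of_def)
      note u = sublinear_INF_chain[OF False A ch]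
      from False obtain q where "q \<in> C" by auto
      with u(2) A(2) have "(\<lambda>x. INF q\<in>C. q x) \<le> p" by (meson order_trans)
      with u show ?thesis by (intro bexI[of _ "\<lambda>x. INF q\<in>C. q x"]) auto
    qed
  qed
  then obtain q where q: "sublinear q" "q \<le> p"
    and min: "\<And>r. sublinear r \<Longrightarrow> r \<le> p \<Longrightarrow> r \<le> q \<Longrightarrow> r = q" by blast
  have "linear q"
    using q min by (intro minimal_sublinear_imp_linear) (auto intro: order_trans)
  with q(2) show ?thesis by (auto simp: le_fun_def)
qed

text \<open>
  A linear functional that lies below the sublinear functional \<open>p\<close> of the proof has both
  properties at once: taking \<open>s = 1\<close> and \<open>d = 0\<close> gives \<open>p \<le> F\<close>, and taking \<open>s = 1\<close> at the point
  \<open>- d\<close> gives \<open>p (- d) \<le> F 0 = 0\<close>. For \<open>D = {0}\<close> this is the existence of a subgradient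
  at \<open>0\<close>; in general, if \<open>0\<close> minimizes \<open>F\<close> over \<open>D\<close>, then some subgradient at \<open>0\<close> is minimized
  over \<open>D\<close> at \<open>0\<close> too.
\<close>

proposition convex_linear_minorant:
  fixes F :: "'v::real_vector \<Rightarrow> real"
  assumes F: "convex_on UNIV F" "F 0 = 0"
    and D: "convex D" "0 \<in> D" "\<And>d. d \<in> D \<Longrightarrow> 0 \<le> F d"
  shows "\<exists>f. linear f \<and> (\<forall>x. f x \<le> F x) \<and> (\<forall>d\<in>D. 0 \<le> f d)"
proof -
  define p where "p x = (INF (s, d)\<in>{0<..} \<times> D. F (s *\<^sub>R x + d) / s)" for x
  have cvx: "F (a *\<^sub>R x + b *\<^sub>R y) \<le> a * F x + b * F y" if "0 \<le> a" "0 \<le> b" "a + b = 1" for a b x y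
    using F(1) that by (auto simp: convex_on_def)
  have low: "- F (- x) \<le> F (s *\<^sub>R x + d) / s" if s: "0 < s" and d: "d \<in> D" for s d x
  proof -
    define a b where "a = 1 / (1 + s)" and "b = s / (1 + s)"
    have ab: "0 \<le> a" "0 \<le> b" "a + b = 1" "b = a * s"
      using s by (auto simp: a_def b_def field_simps)
    have "0 < a" using s by (simp add: a_def)
    \<comment> \<open>\<open>p\<close> does not take the value \<open>-\<infinity>\<close>: the weights put the combination of \<open>s *\<^sub>R x + d\<close> and
      \<open>- x\<close> into \<open>D\<close>, where \<open>F\<close> is nonnegative.\<close>
    have "a *\<^sub>R d + b *\<^sub>R 0 \<in> D"
      using D ab d by (auto simp: convex_def)
    then have "0 \<le> F (a *\<^sub>R d)" using D(3) by simp
    also have "a *\<^sub>R d = a *\<^sub>R (s *\<^sub>R x + d) + b *\<^sub>R (- x)"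
      by (simp add: ab(4) algebra_simps)
    also have "F \<dots> \<le> a * F (s *\<^sub>R x + d) + b * F (- x)"
      by (rule cvx[OF ab(1-3)])
    also have "\<dots> = a * (F (s *\<^sub>R x + d) + s * F (- x))"
      by (simp add: ab(4) algebra_simps)
    finally have "0 \<le> F (s *\<^sub>R x + d) + s * F (- x)"
      using \<open>0 < a\<close> by (simp add: zero_le_mult_iff)
    then show ?thesis using s by (simp add: field_simps)
  qed
  then have bdd: "bdd_below ((\<lambda>(s, d). F (s *\<^sub>R x + d) / s) ` ({0<..} \<times> D))" for x
    by (intro bdd_belowI2[of _ "- F (- x)"]) auto
  have p_le: "p x \<le> F (s *\<^sub>R x + d) / s" if "0 < s" "d \<in> D" for s d x
    unfolding p_def using that by (intro cINF_lower2[OF bdd, of "(s, d)"]) auto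
  have p_ge: "b \<le> p x" if "\<And>s d. 0 < s \<Longrightarrow> d \<in> D \<Longrightarrow> b \<le> F (s *\<^sub>R x + d) / s" for b x
    unfolding p_def using that D(2) by (intro cINF_greatest) (auto intro: exI[of _ 1])
  have "sublinear p"
  proof (rule sublinearI)
    fix x y
    have *: "p (x + y) \<le> F (s *\<^sub>R x + d) / s + F (t *\<^sub>R y + e) / t"
      if st: "0 < s" "0 < t" and de: "d \<in> D" "e \<in> D" for s t d e
    proof -
      \<comment> \<open>these weights give \<open>x\<close> and \<open>y\<close> the common coefficient \<open>r = s * t / (s + t)\<close>\<close>
      define a b where "a = t / (s + t)" and "b = s / (s + t)"
      define r where "r = a * s"
      have ab: "0 \<le> a" "0 \<le> b" "a + b = 1" "b * t = r" "0 < r"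
        using st by (auto simp: a_def b_def r_def add_divide_distrib[symmetric])
      have "a *\<^sub>R d + b *\<^sub>R e \<in> D"
        using D ab de by (auto simp: convex_def)
      then have "p (x + y) \<le> F (r *\<^sub>R (x + y) + (a *\<^sub>R d + b *\<^sub>R e)) / r"
        by (rule p_le[OF \<open>0 < r\<close>])
      also have "r *\<^sub>R (x + y) + (a *\<^sub>R d + b *\<^sub>R e) = a *\<^sub>R (s *\<^sub>R x + d) + b *\<^sub>R (t *\<^sub>R y + e)"
        by (simp add: scaleR_add_right r_def[symmetric] ab(4))
      also have "F \<dots> / r \<le> (a * F (s *\<^sub>R x + d) + b * F (t *\<^sub>R y + e)) / r"
        using cvx[OF ab(1-3)] ab(5) by (intro divide_right_mono) auto
      also have "\<dots> = F (s *\<^sub>R x + d) / s + F (t *\<^sub>R y + e) / t"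
        using st by (simp add: a_def b_def r_def divide_simps)
      finally show ?thesis .
    qed
    have "p (x + y) - F (t *\<^sub>R y + e) / t \<le> p x" if "0 < t" "e \<in> D" for t e
      using *[OF _ that(1) _ that(2)] by (intro p_ge) (simp add: algebra_simps)
    then have "p (x + y) - p x \<le> p y"
      by (intro p_ge) (force simp: algebra_simps)
    then show "p (x + y) \<le> p x + p y" by simp
  next
    fix c :: real and x assume c: "0 < c"
    have "p (c *\<^sub>R x) / c \<le> p x"
    proof (rule p_ge)
      fix s :: real and d assume "0 < s" "d \<in> D"
      then show "p (c *\<^sub>R x) / c \<le> F (s *\<^sub>R x + d) / s"
        using p_le[of "s / c" d "c *\<^sub>R x"] c by (simp add: field_simps)
    qed
    then show "p (c *\<^sub>R x) \<le> c * p x" using c by (simp add: field_simps)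
  next
    have "0 \<le> p 0" by (rule p_ge) (simp add: D(3))
    moreover have "p 0 \<le> 0" using p_le[of 1 0 0] D(2) F(2) by simp
    ultimately show "p 0 = 0" by simp
  qed
  then obtain f where f: "linear f" "\<And>x. f x \<le> p x"
    using hahn_banach_sublinear by blast
  have "f x \<le> F x" for x
    using f(2)[of x] p_le[of 1 0 x] D(2) by simp
  moreover have "0 \<le> f d" if "d \<in> D" for d
    using f(2)[of "- d"] p_le[of 1 d "- d"] that F(2) linear_neg[OF f(1), of d] by simp
  ultimately show ?thesis using f(1) by blast
qed

text \<open>
  A linear projection onto \<open>S\<close> turns a function that is convex on \<open>S\<close> only into one that is convex
  everywhere and unchanged on \<open>S\<close>.
\<close>

lemma convex_linear_minorant_on_subspace:
  fixes F :: "'v::real_vector \<Rightarrow> real"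
  assumes S: "subspace S" and F: "convex_on S F" "F 0 = 0"
    and D: "D \<subseteq> S" "convex D" "0 \<in> D" "\<And>d. d \<in> D \<Longrightarrow> 0 \<le> F d"
  shows "\<exists>f. linear f \<and> (\<forall>x\<in>S. f x \<le> F x) \<and> (\<forall>d\<in>D. 0 \<le> f d)"
proof -
  have "\<exists>g. range g \<subseteq> S \<and> linear g \<and> (\<forall>v\<in>S. g (id v) = v)"
    using S by (intro real_vector.linear_exists_left_inverse_on) (auto simp: id_def linear_ident)
  then obtain g where g: "range g \<subseteq> S" "linear g" "\<And>v. v \<in> S \<Longrightarrow> g v = v" by auto
  have "convex_on UNIV (\<lambda>x. F (g x))"
    using F(1) g(1) unfolding convex_on_def
    by (auto simp: linear_add[OF g(2)] linear_cmul[OF g(2)] image_subset_iff)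
  then have "\<exists>f. linear f \<and> (\<forall>x. f x \<le> F (g x)) \<and> (\<forall>d\<in>D. 0 \<le> f d)"
    by (rule convex_linear_minorant) (use F D g in \<open>auto simp: linear_0\<close>)
  with g(3) show ?thesis by metis
qed

section \<open>Positive functionals on integrable functions\<close>

lemma subspace_integrable: "subspace {X :: 'a \<Rightarrow> real. integrable M X}"
  by (auto simp: subspace_def plus_fun_def zero_fun_def scaleR_fun_def)

lemma linear_pointwise:
  fixes f :: "('a \<Rightarrow> real) \<Rightarrow> real"
  assumes "linear f"
  shows linear_pointwise_add: "f (\<lambda>\<omega>. X \<omega> + Y \<omega>) = f X + f Y"
    and linear_pointwise_diff: "f (\<lambda>\<omega>. X \<omega> - Y \<omega>) = f X - f Y"
    and linear_pointwise_cmult: "f (\<lambda>\<omega>. c * X \<omega>) = c * f X"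
    and linear_pointwise_uminus: "f (\<lambda>\<omega>. - X \<omega>) = - f X"
    and linear_pointwise_zero: "f (\<lambda>\<omega>. 0) = 0"
  using linear_add[OF assms, of X Y] linear_diff[OF assms, of X Y] linear_cmul[OF assms, of c X]
    linear_neg[OF assms, of X] linear_0[OF assms]
  by (simp_all add: plus_fun_def scaleR_fun_def zero_fun_def fun_diff_def fun_Compl_def)

text \<open>
  Linearity is asked on the whole function space, because this is what the Hahn-Banach theorem
  above delivers; positivity concerns the integrable functions only, in the a.e. order.
\<close>

definition positive_functional :: "'a measure \<Rightarrow> (('a \<Rightarrow> real) \<Rightarrow> real) \<Rightarrow> bool" where
  "positive_functional M f \<longleftrightarrow>
     linear f \<and> (\<forall>X. integrable M X \<longrightarrow> (AE \<omega> in M. 0 \<le> X \<omega>) \<longrightarrow> 0 \<le> f X)"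

lemma positive_functional_mono:
  assumes "positive_functional M f" "integrable M X" "integrable M Y" "AE \<omega> in M. X \<omega> \<le> Y \<omega>"
  shows "f X \<le> f Y"
proof -
  have "0 \<le> f (\<lambda>\<omega>. Y \<omega> - X \<omega>)"
    using assms by (auto simp: positive_functional_def)
  then show ?thesis
    using assms(1) by (simp add: linear_pointwise_diff positive_functional_def)
qed

lemma positive_functional_cong:
  assumes "positive_functional M f" "integrable M X" "integrable M Y" "AE \<omega> in M. X \<omega> = Y \<omega>"
  shows "f X = f Y"
proof (rule antisym)
  show "f X \<le> f Y"
    by (rule positive_functional_mono[OF assms(1,2,3)]) (use assms(4) in auto)
  show "f Y \<le> f X"
    by (rule positive_functional_mono[OF assms(1,3,2)]) (use assms(4) in auto)
qed

lemma positive_functional_abs_le: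
  assumes f: "positive_functional M f" and X: "integrable M X"
  shows "\<bar>f X\<bar> \<le> f (\<lambda>\<omega>. \<bar>X \<omega>\<bar>)"
proof -
  have "linear f" using f by (simp add: positive_functional_def)
  then have "- f X = f (\<lambda>\<omega>. - X \<omega>)" by (simp add: linear_pointwise_uminus)
  also have "\<dots> \<le> f (\<lambda>\<omega>. \<bar>X \<omega>\<bar>)"
    using X by (intro positive_functional_mono[OF f]) auto
  finally have "- f X \<le> f (\<lambda>\<omega>. \<bar>X \<omega>\<bar>)" .
  moreover have "f X \<le> f (\<lambda>\<omega>. \<bar>X \<omega>\<bar>)"
    using X by (intro positive_functional_mono[OF f]) auto
  ultimately show ?thesis by simp
qed

lemma summable_integrals_imp_upper_bound:
  fixes U :: "nat \<Rightarrow> 'a \<Rightarrow> real"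
  assumes U: "\<And>n. integrable M (U n)" and nn: "\<And>n. AE \<omega> in M. 0 \<le> U n \<omega>"
    and sm: "summable (\<lambda>n. integral\<^sup>L M (U n))"
  obtains Z where "integrable M Z" "\<And>n. AE \<omega> in M. U n \<omega> \<le> Z \<omega>"
proof -
  have [measurable]: "U n \<in> borel_measurable M" for n using U by auto
  have nn': "AE \<omega> in M. \<forall>n. 0 \<le> U n \<omega>" using nn by (simp add: AE_all_countable)
  have eq: "(\<integral>\<^sup>+\<omega>. ennreal (U n \<omega>) \<partial>M) = ennreal (integral\<^sup>L M (U n))" for n
    by (rule nn_integral_eq_integral[OF U nn])
  have "(\<integral>\<^sup>+\<omega>. (\<Sum>n. ennreal (U n \<omega>)) \<partial>M) = (\<Sum>n. ennreal (integral\<^sup>L M (U n)))"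
    by (subst nn_integral_suminf) (auto simp: eq)
  also have "\<dots> \<noteq> top"
    by (intro ennreal_suminf_neq_top[OF sm] integral_nonneg_AE nn)
  finally have "(\<integral>\<^sup>+\<omega>. (\<Sum>n. ennreal (U n \<omega>)) \<partial>M) < \<infinity>"
    by (simp add: less_top)
  then have "AE \<omega> in M. (\<Sum>n. ennreal (U n \<omega>)) < \<infinity>"
    by (intro finite_nn_integral_imp_ae_finite) auto
  with nn' have summ: "AE \<omega> in M. summable (\<lambda>n. U n \<omega>)"
    by eventually_elim (auto intro!: summable_suminf_not_top)
  show thesis
  proof
    have "AE \<omega> in M. summable (\<lambda>n. norm (U n \<omega>))"
      using summ nn' by eventually_elim simp
    moreover have "(\<integral>\<omega>. norm (U n \<omega>) \<partial>M) = integral\<^sup>L M (U n)" for n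
      using nn[of n] by (intro integral_cong_AE) auto
    ultimately show "integrable M (\<lambda>\<omega>. \<Sum>n. U n \<omega>)"
      using U sm by (intro integrable_suminf) auto
    show "AE \<omega> in M. U n \<omega> \<le> (\<Sum>n. U n \<omega>)" for n
      using summ nn'
    proof eventually_elim
      case (elim \<omega>)
      then show ?case using sum_le_suminf[of "\<lambda>n. U n \<omega>" "{n}"] by auto
    qed
  qed
qed

text \<open>
  Positivity alone forces continuity in the \<open>L\<^sup>1\<close> norm, because \<open>L\<^sup>1\<close> is complete. If \<open>f\<close> were
  unbounded, there would be nonnegative functions of norm \<open>2\<^sup>-\<^sup>n\<close> on which \<open>f\<close> exceeds \<open>2\<^sup>n\<close>. All of
  them lie below their sum, which is integrable, so \<open>f\<close> would be infinite at that sum.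
\<close>

proposition positive_functional_bounded:
  assumes f: "positive_functional M f"
  shows "\<exists>C. \<forall>X. integrable M X \<longrightarrow> \<bar>f X\<bar> \<le> C * (\<integral>\<omega>. \<bar>X \<omega>\<bar> \<partial>M)"
proof -
  have lin: "linear f" using f by (simp add: positive_functional_def)
  have "\<exists>C. \<forall>X. integrable M X \<and> (AE \<omega> in M. 0 \<le> X \<omega>) \<longrightarrow> f X \<le> C * integral\<^sup>L M X"
  proof (rule ccontr)
    assume "\<not> ?thesis"
    then have "\<forall>n::nat. \<exists>X. (integrable M X \<and> (AE \<omega> in M. 0 \<le> X \<omega>)) \<and> 4 ^ n * integral\<^sup>L M X < f X"
      by (metis not_le)
    then have "\<exists>X. \<forall>n::nat. (integrable M (X n) \<and> (AE \<omega> in M. 0 \<le> X n \<omega>)) \<and>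
        4 ^ n * integral\<^sup>L M (X n) < f (X n)"
      by (rule choice)
    then obtain X where X: "\<And>n. integrable M (X n)" "\<And>n. AE \<omega> in M. 0 \<le> X n \<omega>"
      and fX: "\<And>n::nat. 4 ^ n * integral\<^sup>L M (X n) < f (X n)" by blast
    have pos: "0 < integral\<^sup>L M (X n)" for n
    proof -
      have "integral\<^sup>L M (X n) \<noteq> 0"
      proof
        assume "integral\<^sup>L M (X n) = 0"
        then have "f (X n) = f (\<lambda>_. 0)"
          using X[of n] by (intro positive_functional_cong[OF f]) (auto simp: integral_nonneg_eq_0_iff_AE)
        with fX[of n] \<open>integral\<^sup>L M (X n) = 0\<close> show False
          by (simp add: linear_pointwise_zero[OF lin])
      qed
      moreover have "0 \<le> integral\<^sup>L M (X n)" by (rule integral_nonneg_AE[OF X(2)])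
      ultimately show ?thesis by simp
    qed
    define c where "c n = (1 / 2) ^ n / integral\<^sup>L M (X n)" for n
    have c: "0 < c n" for n using pos[of n] by (simp add: c_def)
    have int: "integral\<^sup>L M (\<lambda>\<omega>. c n * X n \<omega>) = (1 / 2) ^ n" for n
      using pos[of n] by (simp add: c_def)
    obtain Z where Z: "integrable M Z" "\<And>n. AE \<omega> in M. c n * X n \<omega> \<le> Z \<omega>"
    proof (rule summable_integrals_imp_upper_bound[of M "\<lambda>n \<omega>. c n * X n \<omega>"])
      show "AE \<omega> in M. 0 \<le> c n * X n \<omega>" for n
        using X(2)[of n] c[of n] by (auto simp: zero_le_mult_iff less_imp_le)
      show "summable (\<lambda>n. \<integral>\<omega>. c n * X n \<omega> \<partial>M)"
        unfolding int by (simp add: summable_geometric)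
    qed (use X(1) in auto)
    have "2 ^ n < f Z" for n
    proof -
      have "(2::real) ^ n = c n * (4 ^ n * integral\<^sup>L M (X n))"
        using pos[of n] by (simp add: c_def flip: power_mult_distrib)
      also have "\<dots> < c n * f (X n)"
        using fX c by (intro mult_strict_left_mono)
      also have "\<dots> = f (\<lambda>\<omega>. c n * X n \<omega>)"
        by (simp add: linear_pointwise_cmult[OF lin])
      also have "\<dots> \<le> f Z"
        using X(1) Z by (intro positive_functional_mono[OF f]) auto
      finally show ?thesis .
    qed
    moreover obtain n where "f Z < 2 ^ n" using real_arch_pow[of 2 "f Z"] by auto
    ultimately show False by (meson less_asym)
  qed
  then obtain C where C: "\<And>X. integrable M X \<Longrightarrow> (AE \<omega> in M. 0 \<le> X \<omega>) \<Longrightarrow> f X \<le> C * integral\<^sup>L M X"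
    by blast
  have "\<bar>f X\<bar> \<le> C * (\<integral>\<omega>. \<bar>X \<omega>\<bar> \<partial>M)" if "integrable M X" for X
    using positive_functional_abs_le[OF f that] C[of "\<lambda>\<omega>. \<bar>X \<omega>\<bar>"] that by force
  then show ?thesis by blast
qed

lemma (in prob_space) ac_probs_real_density:
  assumes P: "P \<in> ac_probs M"
  obtains D :: "'a \<Rightarrow> real" where "D \<in> borel_measurable M"
    "AE \<omega> in M. RN_deriv M P \<omega> = ennreal (D \<omega>)" "\<And>\<omega>. 0 \<le> D \<omega>"
    "P = density M (\<lambda>\<omega>. ennreal (D \<omega>))"
proof -
  from P have P': "sets P = sets M" "absolutely_continuous M P" and "prob_space P"
    by (auto simp: ac_probs_def)
  interpret P: prob_space P by fact
  obtain D where [measurable]: "D \<in> borel_measurable M"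
    and RN: "AE \<omega> in M. RN_deriv M P \<omega> = ennreal (D \<omega>)" and nn: "\<And>\<omega>. 0 \<le> D \<omega>"
    using real_RN_deriv[OF P.finite_measure_axioms P'(2,1)] by metis
  have "P = density M (RN_deriv M P)"
    using density_RN_deriv[OF P'(2,1)] by simp
  also have "\<dots> = density M (\<lambda>\<omega>. ennreal (D \<omega>))"
    using RN by (intro density_cong) auto
  finally show thesis
    by (rule that[OF \<open>D \<in> borel_measurable M\<close> RN nn])
qed

text \<open>
  The density cannot exceed \<open>C\<close> on a set of positive measure: on the set where it does, integrating
  it gives more than \<open>C\<close> times the measure.
\<close>

lemma (in prob_space) dominated_imp_bounded_density:
  assumes P: "P \<in> ac_probs M" and le: "\<And>A. A \<in> sets M \<Longrightarrow> measure P A \<le> C * measure M A"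
  shows "bounded_density M P"
proof -
  from P have P': "sets P = sets M" "absolutely_continuous M P" and "prob_space P"
    by (auto simp: ac_probs_def)
  interpret P: prob_space P by fact
  obtain D where [measurable]: "D \<in> borel_measurable M"
    and RN: "AE \<omega> in M. RN_deriv M P \<omega> = ennreal (D \<omega>)" and nn: "\<And>\<omega>. 0 \<le> D \<omega>"
    and dens: "P = density M (\<lambda>\<omega>. ennreal (D \<omega>))"
    using ac_probs_real_density[OF P] by blast
  have "integrable P (\<lambda>_. 1::real)" by simp
  then have D: "integrable M D"
    by (subst (asm) dens, subst (asm) integrable_real_density) (auto simp: nn)
  define A where "A = {\<omega> \<in> space M. C < D \<omega>}"
  have [measurable]: "A \<in> sets M" unfolding A_def by measurable
  have "measure P A = (\<integral>\<omega>. indicator A \<omega> \<partial>P)"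
    using P'(1) by simp
  also have "\<dots> = (\<integral>\<omega>. D \<omega> * indicator A \<omega> \<partial>M)"
    by (subst dens, subst integral_real_density) (auto simp: nn)
  finally have PA: "measure P A = (\<integral>\<omega>. D \<omega> * indicator A \<omega> \<partial>M)" .
  have DA: "integrable M (\<lambda>\<omega>. D \<omega> * indicator A \<omega>)"
    using D by (simp add: integrable_mult_indicator mult.commute integrable_real_mult_indicator)
  have CA: "integrable M (\<lambda>\<omega>. C * indicator A \<omega>)"
    by (simp add: emeasure_eq_measure)
  have eq: "(D \<omega> - C) * indicator A \<omega> = D \<omega> * indicator A \<omega> - C * indicator A \<omega>" for \<omega>
    by (simp add: algebra_simps)
  have "(\<integral>\<omega>. (D \<omega> - C) * indicator A \<omega> \<partial>M) = measure P A - C * measure M A"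
    unfolding eq using DA CA by (simp add: PA)
  also have "\<dots> \<le> 0" using le[of A] by simp
  finally have "(\<integral>\<omega>. (D \<omega> - C) * indicator A \<omega> \<partial>M) \<le> 0" .
  moreover have nnA: "AE \<omega> in M. 0 \<le> (D \<omega> - C) * indicator A \<omega>"
    by (intro AE_I2) (auto simp: A_def indicator_def)
  ultimately have "(\<integral>\<omega>. (D \<omega> - C) * indicator A \<omega> \<partial>M) = 0"
    using integral_nonneg_AE[OF nnA] by simp
  moreover have "integrable M (\<lambda>\<omega>. (D \<omega> - C) * indicator A \<omega>)"
    unfolding eq using DA CA by simp
  ultimately have "AE \<omega> in M. (D \<omega> - C) * indicator A \<omega> = 0"
    using nnA by (simp add: integral_nonneg_eq_0_iff_AE)
  with RN AE_space have "AE \<omega> in M. RN_deriv M P \<omega> \<le> ennreal C"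
    by eventually_elim (auto simp: A_def indicator_def not_less intro!: ennreal_leI split: if_splits)
  then show ?thesis by (auto simp: bounded_density_def)
qed

lemma (in prob_space) bounded_density_integral:
  assumes P: "P \<in> ac_probs M" and bd: "bounded_density M P"
  shows "\<exists>G. G \<in> borel_measurable M \<and> (AE \<omega> in M. RN_deriv M P \<omega> = ennreal (G \<omega>)) \<and> (\<forall>\<omega>. 0 \<le> G \<omega>) \<and>
    (\<forall>X::'a \<Rightarrow> real. integrable M X \<longrightarrow> integrable P X \<and> integrable M (\<lambda>\<omega>. G \<omega> * X \<omega>) \<and>
      integral\<^sup>L P X = (\<integral>\<omega>. G \<omega> * X \<omega> \<partial>M))"
proof -
  obtain D where [measurable]: "D \<in> borel_measurable M"
    and RN: "AE \<omega> in M. RN_deriv M P \<omega> = ennreal (D \<omega>)" and nn: "\<And>\<omega>. 0 \<le> D \<omega>"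
    and dens: "P = density M (\<lambda>\<omega>. ennreal (D \<omega>))"
    using ac_probs_real_density[OF P] by blast
  obtain C :: real where C: "AE \<omega> in M. RN_deriv M P \<omega> \<le> ennreal C"
    using bd by (auto simp: bounded_density_def)
  have bound: "AE \<omega> in M. D \<omega> \<le> \<bar>C\<bar>"
    using RN C
  proof eventually_elim
    case (elim \<omega>)
    then have "ennreal (D \<omega>) \<le> ennreal \<bar>C\<bar>" by (metis abs_ge_self ennreal_leI order_trans)
    then show ?case by simp
  qed
  have "integrable P X \<and> integrable M (\<lambda>\<omega>. D \<omega> * X \<omega>) \<and> integral\<^sup>L P X = (\<integral>\<omega>. D \<omega> * X \<omega> \<partial>M)"
    if X: "integrable M X" for X :: "'a \<Rightarrow> real"
  proof -
    have int: "integrable M (\<lambda>\<omega>. D \<omega> * X \<omega>)"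
    proof (rule Bochner_Integration.integrable_bound)
      show "integrable M (\<lambda>\<omega>. \<bar>C\<bar> * X \<omega>)" using X by simp
      show "AE \<omega> in M. norm (D \<omega> * X \<omega>) \<le> norm (\<bar>C\<bar> * X \<omega>)"
        using bound by eventually_elim (simp add: abs_mult nn mult_right_mono)
    qed (use X in measurable)
    moreover have "integrable P X"
      using int X by (subst dens, subst integrable_real_density) (auto simp: nn)
    moreover have "integral\<^sup>L P X = (\<integral>\<omega>. D \<omega> * X \<omega> \<partial>M)"
      using X by (subst dens, subst integral_real_density) (auto simp: nn)
    ultimately show ?thesis by blast
  qed
  then show ?thesis
    using RN nn \<open>D \<in> borel_measurable M\<close> by (intro exI[of _ D]) simp
qed

text \<open>
  The Riesz representation of the dual of \<open>L\<^sup>1\<close>, for positive functionals. The bound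
  \<open>\<bar>f X\<bar> \<le> C * E\<bar>X\<bar>\<close> makes \<open>A \<mapsto> f (indicator A)\<close> countably additive and absolutely continuous, it
  bounds the density of the resulting measure by \<open>C\<close>, and it carries the identity from simple
  functions over to their \<open>L\<^sup>1\<close> limits.
\<close>

proposition (in prob_space) positive_functional_eq_integral:
  assumes f: "positive_functional M f" and one: "f (\<lambda>_. 1) = 1"
  shows "\<exists>P\<in>ac_probs M. bounded_density M P \<and> (\<forall>X. integrable M X \<longrightarrow> f X = integral\<^sup>L P X)"
proof -
  have lin: "linear f" using f by (simp add: positive_functional_def)
  obtain C where C: "\<And>X. integrable M X \<Longrightarrow> \<bar>f X\<bar> \<le> C * (\<integral>\<omega>. \<bar>X \<omega>\<bar> \<partial>M)"
    using positive_functional_bounded[OF f] by blast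
  have ind: "integrable M (indicator A :: 'a \<Rightarrow> real)" if "A \<in> sets M" for A
    using that by (simp add: emeasure_eq_measure)
  have nn: "0 \<le> f (indicator A)" if "A \<in> sets M" for A
    using f ind[OF that] by (auto simp: positive_functional_def)
  have le: "f (indicator A) \<le> C * measure M A" if "A \<in> sets M" for A
    using C[OF ind[OF that]] that by simp
  define P where "P = measure_of (space M) (sets M) (\<lambda>A. ennreal (f (indicator A)))"
  have sets_P: "sets P = sets M" and space_P: "space P = space M"
    by (simp_all add: P_def)
  have "(indicator {} :: 'a \<Rightarrow> real) = (\<lambda>\<omega>. 0)" by (simp add: fun_eq_iff)
  then have pos: "positive (sets M) (\<lambda>A. ennreal (f (indicator A)))"
    using linear_pointwise_zero[OF lin] by (simp add: positive_def)
  have add: "additive (sets M) (\<lambda>A. ennreal (f (indicator A)))"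
  proof (unfold additive_def, intro ballI impI)
    fix A B assume AB: "A \<in> sets M" "B \<in> sets M" "A \<inter> B = {}"
    have "(indicator (A \<union> B) :: 'a \<Rightarrow> real) = (\<lambda>\<omega>. indicator A \<omega> + indicator B \<omega>)"
      using AB(3) by (auto simp: fun_eq_iff indicator_def)
    then show "ennreal (f (indicator (A \<union> B))) = ennreal (f (indicator A)) + ennreal (f (indicator B))"
      using nn AB by (simp add: linear_pointwise_add[OF lin] ennreal_plus[symmetric] del: ennreal_plus)
  qed
  have "countably_additive (sets M) (\<lambda>A. ennreal (f (indicator A)))"
  proof (rule sets.empty_continuous_imp_countably_additive[OF pos add])
    fix A :: "nat \<Rightarrow> 'a set"
    assume A: "range A \<subseteq> sets M" "decseq A" "(\<Inter>i. A i) = {}"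
    have "(\<lambda>i. C * measure M (A i)) \<longlonglongrightarrow> C * measure M (\<Inter>i. A i)"
      using A by (intro tendsto_mult tendsto_const finite_Lim_measure_decseq)
    then have "(\<lambda>i. C * measure M (A i)) \<longlonglongrightarrow> 0" by (simp add: A(3))
    moreover have "A i \<in> sets M" for i using A(1) by auto
    then have "\<forall>\<^sub>F i in sequentially. norm (f (indicator (A i))) \<le> C * measure M (A i)"
      using nn le by simp
    ultimately have "(\<lambda>i. f (indicator (A i))) \<longlonglongrightarrow> 0"
      by (rule Lim_null_comparison[rotated])
    then show "(\<lambda>i. ennreal (f (indicator (A i)))) \<longlonglongrightarrow> 0"
      using tendsto_ennrealI[of _ 0] by simp
  qed simp
  then have emeasure_P: "emeasure P A = ennreal (f (indicator A))" if "A \<in> sets M" for A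
    unfolding P_def using pos that sets.sigma_algebra_axioms
    by (intro emeasure_measure_of_sigma) auto
  have "f (indicator (space M)) = f (\<lambda>_. 1)"
    by (rule positive_functional_cong[OF f]) (auto intro!: ind)
  then have "prob_space P"
    by (intro prob_spaceI) (simp add: space_P emeasure_P one)
  then interpret P: prob_space P .
  have measure_P: "measure P A = f (indicator A)" if "A \<in> sets M" for A
    using emeasure_P[OF that] nn[OF that] by (simp add: P.emeasure_eq_measure)
  have "absolutely_continuous M P"
    unfolding absolutely_continuous_def
  proof
    fix A assume "A \<in> null_sets M"
    then have A: "A \<in> sets M" "measure M A = 0" by (auto simp: measure_def)
    then show "A \<in> null_sets P"
      using nn[OF A(1)] le[OF A(1)] by (auto simp: emeasure_P sets_P)
  qed
  then have P: "P \<in> ac_probs M"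
    using sets_P P.prob_space_axioms by (simp add: ac_probs_def)
  have bd: "bounded_density M P"
    by (rule dominated_imp_bounded_density[OF P, of C]) (simp add: measure_P le)
  have int_P: "integrable P X" if "integrable M X" for X :: "'a \<Rightarrow> real"
    using bounded_density_integral[OF P bd] that by (elim exE conjE) simp
  have "f X = integral\<^sup>L P X" if "integrable M X" for X
    using that
  proof (induction rule: integrable_induct)
    case (base A c)
    have "f (\<lambda>\<omega>. indicator A \<omega> *\<^sub>R c) = c * f (indicator A)"
      using linear_pointwise_cmult[OF lin, of c "indicator A"] by (simp add: mult.commute)
    then show ?case using base by (simp add: measure_P sets_P mult.commute)
  next
    case (add X Y)
    then show ?case by (simp add: linear_pointwise_add[OF lin] int_P)
  next
    case (lim X S)
    have "(\<lambda>i. \<integral>\<omega>. \<bar>S i \<omega> - X \<omega>\<bar> \<partial>M) \<longlonglongrightarrow> (\<integral>\<omega>. 0 \<partial>M)"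
    proof (rule integral_dominated_convergence)
      show "integrable M (\<lambda>\<omega>. 3 * \<bar>X \<omega>\<bar>)" using lim by simp
      show "AE \<omega> in M. (\<lambda>i. \<bar>S i \<omega> - X \<omega>\<bar>) \<longlonglongrightarrow> 0"
        by (intro AE_I2 tendsto_rabs_zero LIM_zero lim.hyps(2))
      show "AE \<omega> in M. norm \<bar>S i \<omega> - X \<omega>\<bar> \<le> 3 * \<bar>X \<omega>\<bar>" for i
      proof (rule AE_I2)
        fix \<omega> assume "\<omega> \<in> space M"
        then show "norm \<bar>S i \<omega> - X \<omega>\<bar> \<le> 3 * \<bar>X \<omega>\<bar>"
          using lim.hyps(3)[of \<omega> i] by simp
      qed
    qed (use lim in auto)
    then have "(\<lambda>i. C * (\<integral>\<omega>. \<bar>S i \<omega> - X \<omega>\<bar> \<partial>M)) \<longlonglongrightarrow> C * 0"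
      by (intro tendsto_mult tendsto_const) simp
    then have "(\<lambda>i. f (S i) - f X) \<longlonglongrightarrow> 0"
    proof (intro Lim_null_comparison[where f="\<lambda>i. f (S i) - f X"])
      show "\<forall>\<^sub>F i in sequentially. norm (f (S i) - f X) \<le> C * (\<integral>\<omega>. \<bar>S i \<omega> - X \<omega>\<bar> \<partial>M)"
        using lim C[of "\<lambda>\<omega>. S i \<omega> - X \<omega>" for i] by (simp add: linear_pointwise_diff[OF lin])
    qed simp
    then have "(\<lambda>i. f (S i)) \<longlonglongrightarrow> f X" by (rule LIM_zero_cancel)
    moreover have "(\<lambda>i. integral\<^sup>L P (S i)) \<longlonglongrightarrow> integral\<^sup>L P X"
    proof (rule integral_dominated_convergence)
      show "integrable P (\<lambda>\<omega>. 2 * norm (X \<omega>))" using lim by (simp add: int_P)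
      show "AE \<omega> in P. (\<lambda>i. S i \<omega>) \<longlonglongrightarrow> X \<omega>"
        using lim.hyps(2) by (auto simp: space_P)
      show "AE \<omega> in P. norm (S i \<omega>) \<le> 2 * norm (X \<omega>)" for i
        using lim.hyps(3) by (auto simp: space_P)
    qed (use lim int_P in auto)
    ultimately show ?case
      using lim.IH LIMSEQ_unique by simp
  qed
  with P bd show ?thesis by blast
qed

section \<open>Subgradients of convex expectations\<close>

lemma convex_expectation_mono:
  "convex_expectation M \<rho> \<Longrightarrow> integrable M X \<Longrightarrow> integrable M Y \<Longrightarrow> AE \<omega> in M. X \<omega> \<le> Y \<omega> \<Longrightarrow> \<rho> X \<le> \<rho> Y"
  and convex_expectation_add_const:
  "convex_expectation M \<rho> \<Longrightarrow> integrable M X \<Longrightarrow> \<rho> (\<lambda>\<omega>. X \<omega> + c) = \<rho> X + c"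
  by (auto simp: convex_expectation_def)

lemma convex_expectation_convex:
  assumes "convex_expectation M \<rho>" "integrable M X" "integrable M Y" "0 \<le> u" "0 \<le> v" "u + v = 1"
  shows "\<rho> (\<lambda>\<omega>. u * X \<omega> + v * Y \<omega>) \<le> u * \<rho> X + v * \<rho> Y"
proof -
  have "v = 1 - u" "u \<in> {0..1}" using assms by auto
  with assms show ?thesis by (auto simp: convex_expectation_def)
qed

definition subgradient :: "'a measure \<Rightarrow> (('a \<Rightarrow> real) \<Rightarrow> real) \<Rightarrow> ('a \<Rightarrow> real) \<Rightarrow> 'a measure \<Rightarrow> bool" where
  "subgradient M \<rho> X P \<longleftrightarrow>
     (\<forall>Y. integrable M Y \<longrightarrow> \<rho> X + (\<integral>\<omega>. Y \<omega> - X \<omega> \<partial>P) \<le> \<rho> Y)"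

lemma subgradientD:
  "subgradient M \<rho> X P \<Longrightarrow> integrable M Y \<Longrightarrow> \<rho> X + (\<integral>\<omega>. Y \<omega> - X \<omega> \<partial>P) \<le> \<rho> Y"
  by (simp add: subgradient_def)

text \<open>
  Monotonicity of \<open>\<rho>\<close> makes a linear minorant of its increments positive, and translation invariance
  makes it take the value \<open>1\<close> at the constant \<open>1\<close>. The measure that represents it attains the
  supremum in its penalty at \<open>X\<close>, hence has finite penalty.
\<close>

lemma (in prob_space) minorant_eq_integral:
  assumes \<rho>: "convex_expectation M \<rho>" and X: "integrable M X" and f: "linear f"
    and le: "\<And>U. integrable M U \<Longrightarrow> f U \<le> \<rho> (\<lambda>\<omega>. X \<omega> + U \<omega>) - \<rho> X"
  shows "\<exists>P\<in>finite_penalty_probs M \<rho>.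
    subgradient M \<rho> X P \<and> (\<forall>U. integrable M U \<longrightarrow> f U = integral\<^sup>L P U)"
proof -
  have "0 \<le> f U" if U: "integrable M U" "AE \<omega> in M. 0 \<le> U \<omega>" for U
  proof -
    have "- f U = f (\<lambda>\<omega>. - U \<omega>)" by (simp add: linear_pointwise_uminus[OF f])
    also have "\<dots> \<le> \<rho> (\<lambda>\<omega>. X \<omega> + - U \<omega>) - \<rho> X" using U by (intro le) auto
    also have "\<dots> \<le> 0" using U X convex_expectation_mono[OF \<rho>, of "\<lambda>\<omega>. X \<omega> + - U \<omega>" X] by auto
    finally show ?thesis by simp
  qed
  then have pos: "positive_functional M f" using f by (simp add: positive_functional_def)
  have const: "f (\<lambda>\<omega>. c) \<le> c" for c
    using le[of "\<lambda>\<omega>. c"] convex_expectation_add_const[OF \<rho> X, of c] by simp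
  have "f (\<lambda>\<omega>. 1) = 1"
    using const[of 1] const[of "-1"] linear_pointwise_uminus[OF f, of "\<lambda>\<omega>. 1"] by simp
  then obtain P where P: "P \<in> ac_probs M" "bounded_density M P"
    and eq: "\<And>U. integrable M U \<Longrightarrow> f U = integral\<^sup>L P U"
    using positive_functional_eq_integral[OF pos] by blast
  have le': "f Y - f X \<le> \<rho> Y - \<rho> X" if "integrable M Y" for Y
    using le[of "\<lambda>\<omega>. Y \<omega> - X \<omega>"] that X by (simp add: linear_pointwise_diff[OF f])
  have "penalty M \<rho> P \<le> ereal (f X - \<rho> X)"
    unfolding penalty_def
  proof (rule SUP_least)
    fix Y :: "'a \<Rightarrow> real" assume "Y \<in> {X. integrable M X}"
    then show "ereal (integral\<^sup>L P Y - \<rho> Y) \<le> ereal (f X - \<rho> X)"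
      using eq[of Y] le'[of Y] by simp
  qed
  also have "\<dots> < \<infinity>" by simp
  finally have "P \<in> finite_penalty_probs M \<rho>"
    using P by (simp add: finite_penalty_probs_def)
  moreover have "subgradient M \<rho> X P"
    unfolding subgradient_def
  proof (intro allI impI)
    fix Y :: "'a \<Rightarrow> real" assume "integrable M Y"
    then show "\<rho> X + (\<integral>\<omega>. Y \<omega> - X \<omega> \<partial>P) \<le> \<rho> Y"
      using le'[of Y] eq[of "\<lambda>\<omega>. Y \<omega> - X \<omega>"] X by (simp add: linear_pointwise_diff[OF f])
  qed
  ultimately show ?thesis using eq by blast
qed

lemma convex_on_affine_expectation:
  assumes \<rho>: "convex_expectation M \<rho>" and X: "integrable M X"
  shows "convex_on {U. integrable M U} (\<lambda>U. \<rho> (\<lambda>\<omega>. X \<omega> + c * U \<omega>) - d)"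
  unfolding convex_on_def
proof (intro conjI ballI allI impI)
  show "convex {U :: 'a \<Rightarrow> real. integrable M U}"
    by (rule subspace_imp_convex[OF subspace_integrable])
next
  fix U V :: "'a \<Rightarrow> real" and u v :: real
  assume UV: "U \<in> {U. integrable M U}" "V \<in> {U. integrable M U}" and uv: "0 \<le> u" "0 \<le> v" "u + v = 1"
  have split: "r = u * r + v * r" for r by (metis distrib_right mult_1 uv(3))
  have "(\<lambda>\<omega>. X \<omega> + c * (u *\<^sub>R U + v *\<^sub>R V) \<omega>)
      = (\<lambda>\<omega>. u * (X \<omega> + c * U \<omega>) + v * (X \<omega> + c * V \<omega>))"
    using split[of "X _"] by (simp add: fun_eq_iff algebra_simps)
  then have "\<rho> (\<lambda>\<omega>. X \<omega> + c * (u *\<^sub>R U + v *\<^sub>R V) \<omega>)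
      \<le> u * \<rho> (\<lambda>\<omega>. X \<omega> + c * U \<omega>) + v * \<rho> (\<lambda>\<omega>. X \<omega> + c * V \<omega>)"
    using convex_expectation_convex[OF \<rho> _ _ uv, of "\<lambda>\<omega>. X \<omega> + c * U \<omega>" "\<lambda>\<omega>. X \<omega> + c * V \<omega>"] UV X
    by simp
  then show "\<rho> (\<lambda>\<omega>. X \<omega> + c * (u *\<^sub>R U + v *\<^sub>R V) \<omega>) - d
      \<le> u * (\<rho> (\<lambda>\<omega>. X \<omega> + c * U \<omega>) - d) + v * (\<rho> (\<lambda>\<omega>. X \<omega> + c * V \<omega>) - d)"
    using split[of d] by (simp add: right_diff_distrib)
qed

lemmas convex_on_shifted_expectation = convex_on_affine_expectation[where c = 1, simplified]

lemma (in prob_space) subgradient_ex: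
  assumes \<rho>: "convex_expectation M \<rho>" and X: "integrable M X"
  shows "\<exists>P\<in>finite_penalty_probs M \<rho>. subgradient M \<rho> X P"
proof -
  let ?L = "{U :: 'a \<Rightarrow> real. integrable M U}"
  have "\<exists>f. linear f \<and> (\<forall>U\<in>?L. f U \<le> \<rho> (\<lambda>\<omega>. X \<omega> + U \<omega>) - \<rho> X) \<and> (\<forall>d\<in>{0}. 0 \<le> f d)"
    by (rule convex_linear_minorant_on_subspace[OF subspace_integrable convex_on_shifted_expectation[OF \<rho> X]])
      (auto simp: zero_fun_def)
  then show ?thesis
    using minorant_eq_integral[OF \<rho> X] by blast
qed

text \<open>
  For a vanishing multiplier the functional is zero and determines no measure; any
  subgradient then serves.
\<close>

lemma (in prob_space) scaled_minorant_eq_integral: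
  assumes \<rho>: "convex_expectation M \<rho>" and X: "integrable M X" and f: "linear f" and a: "0 \<le> a"
    and le: "\<And>U. integrable M U \<Longrightarrow> f U \<le> a * (\<rho> (\<lambda>\<omega>. X \<omega> + U \<omega>) - \<rho> X)"
  shows "\<exists>P\<in>finite_penalty_probs M \<rho>.
    subgradient M \<rho> X P \<and> (\<forall>U. integrable M U \<longrightarrow> f U = a * integral\<^sup>L P U)"
proof (cases "a = 0")
  case True
  have "f U = 0" if "integrable M U" for U
    using le[OF that] le[of "\<lambda>\<omega>. - U \<omega>"] that True by (simp add: linear_pointwise_uminus[OF f])
  then show ?thesis using subgradient_ex[OF \<rho> X] True by auto
next
  case False
  with a have a: "0 < a" by simp
  have "linear (\<lambda>U. f U / a)"
    using linear_compose_scale_right[OF f, of "inverse a"] by (simp add: divide_inverse mult.commute)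
  moreover have "f U / a \<le> \<rho> (\<lambda>\<omega>. X \<omega> + U \<omega>) - \<rho> X" if "integrable M U" for U
    using le[OF that] a by (simp add: pos_divide_le_eq mult.commute)
  ultimately have "\<exists>P\<in>finite_penalty_probs M \<rho>.
    subgradient M \<rho> X P \<and> (\<forall>U. integrable M U \<longrightarrow> f U / a = integral\<^sup>L P U)"
    by (rule minorant_eq_integral[OF \<rho> X])
  then show ?thesis using a by (auto simp: field_simps)
qed

text \<open>
  The sum rule of convex analysis, together with the optimality condition on \<open>D\<close>. Applying the
  Hahn-Banach theorem in \<open>L\<^sup>1 \<times> L\<^sup>1\<close>, to the function \<open>(U, V) \<mapsto> a * (\<rho> (X + U) - \<rho> X) + b * (\<sigma> (Y + V) - \<sigma> Y)\<close>
  and to the convex set of all pairs \<open>(U, - U)\<close> with \<open>U \<in> D\<close>, yields one linear functional. Its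
  restrictions to the two factors are \<open>a\<close> times integration against \<open>P\<close> and \<open>b\<close> times integration
  against \<open>Q\<close>.
\<close>

proposition (in prob_space) joint_subgradients:
  assumes \<rho>: "convex_expectation M \<rho>" "convex_expectation M \<sigma>"
    and XY: "integrable M X" "integrable M Y" and ab: "0 \<le> a" "0 \<le> b"
    and D: "D \<subseteq> {U. integrable M U}" "convex D" "0 \<in> D"
    and nn: "\<And>U. U \<in> D \<Longrightarrow>
      0 \<le> a * (\<rho> (\<lambda>\<omega>. X \<omega> + U \<omega>) - \<rho> X) + b * (\<sigma> (\<lambda>\<omega>. Y \<omega> - U \<omega>) - \<sigma> Y)"
  shows "\<exists>P\<in>finite_penalty_probs M \<rho>. \<exists>Q\<in>finite_penalty_probs M \<sigma>.
    subgradient M \<rho> X P \<and> subgradient M \<sigma> Y Q \<and>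
    (\<forall>U\<in>D. 0 \<le> a * integral\<^sup>L P U - b * integral\<^sup>L Q U)"
proof -
  let ?L = "{U :: 'a \<Rightarrow> real. integrable M U}"
  let ?r = "\<lambda>U. \<rho> (\<lambda>\<omega>. X \<omega> + U \<omega>) - \<rho> X" and ?s = "\<lambda>V. \<sigma> (\<lambda>\<omega>. Y \<omega> + V \<omega>) - \<sigma> Y"
  have r: "convex_on ?L ?r" and s: "convex_on ?L ?s"
    by (rule convex_on_shifted_expectation[OF \<rho>(1) XY(1)], rule convex_on_shifted_expectation[OF \<rho>(2) XY(2)])
  have "convex_on (?L \<times> ?L) (\<lambda>(U, V). a * ?r U + b * ?s V)"
    unfolding convex_on_def
  proof (intro conjI ballI allI impI)
    show "convex (?L \<times> ?L)"
      using r by (intro convex_Times) (auto simp: convex_on_def)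
  next
    fix p q u v assume pq: "p \<in> ?L \<times> ?L" "q \<in> ?L \<times> ?L" and uv: "0 \<le> u" "0 \<le> v" "u + v = (1::real)"
    obtain U V U' V' where UV: "p = (U, V)" "q = (U', V')" by (cases p, cases q)
    have "a * ?r (u *\<^sub>R U + v *\<^sub>R U') \<le> a * (u * ?r U + v * ?r U')"
      using r pq uv ab UV unfolding convex_on_def by (intro mult_left_mono) blast+
    moreover have "b * ?s (u *\<^sub>R V + v *\<^sub>R V') \<le> b * (u * ?s V + v * ?s V')"
      using s pq uv ab UV unfolding convex_on_def by (intro mult_left_mono) blast+
    ultimately show "(case u *\<^sub>R p + v *\<^sub>R q of (U, V) \<Rightarrow> a * ?r U + b * ?s V)
        \<le> u * (case p of (U, V) \<Rightarrow> a * ?r U + b * ?s V) + v * (case q of (U, V) \<Rightarrow> a * ?r U + b * ?s V)"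
      by (simp add: UV algebra_simps)
  qed
  moreover have "convex ((\<lambda>U. (U, - U)) ` D)"
    using D(2) by (intro convex_linear_image) (auto intro!: linearI)
  moreover have "(\<lambda>U. (U, - U)) ` D \<subseteq> ?L \<times> ?L"
    using D(1) by (auto simp: fun_Compl_def)
  moreover have "subspace (?L \<times> ?L)"
    by (intro subspace_Times subspace_integrable)
  moreover have "0 \<in> (\<lambda>U. (U, - U)) ` D"
    using D(3) by (auto simp: image_iff zero_prod_def)
  ultimately have "\<exists>f. linear f \<and> (\<forall>p\<in>?L \<times> ?L. f p \<le> (\<lambda>(U, V). a * ?r U + b * ?s V) p) \<and>
      (\<forall>d\<in>(\<lambda>U. (U, - U)) ` D. 0 \<le> f d)"
    by (intro convex_linear_minorant_on_subspace) (use nn in \<open>auto simp: zero_prod_def\<close>)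
  then obtain f where f: "linear f"
    and le: "\<And>U V. integrable M U \<Longrightarrow> integrable M V \<Longrightarrow> f (U, V) \<le> a * ?r U + b * ?s V"
    and ge: "\<And>U. U \<in> D \<Longrightarrow> 0 \<le> f (U, - U)" by auto
  have f1: "linear (\<lambda>U. f (U, 0))" and f2: "linear (\<lambda>V. f (0, V))"
    using linear_compose[of "\<lambda>U. (U, 0)" f] linear_compose[of "\<lambda>V. (0, V)" f] f
    by (simp_all add: o_def linear_iff)
  have zero: "integrable M (0 :: 'a \<Rightarrow> real)" by (simp add: zero_fun_def)
  obtain P where P: "P \<in> finite_penalty_probs M \<rho>" "subgradient M \<rho> X P"
      "\<And>U. integrable M U \<Longrightarrow> f (U, 0) = a * integral\<^sup>L P U"
    using scaled_minorant_eq_integral[OF \<rho>(1) XY(1) f1 ab(1)] le[OF _ zero] by auto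
  obtain Q where Q: "Q \<in> finite_penalty_probs M \<sigma>" "subgradient M \<sigma> Y Q"
      "\<And>V. integrable M V \<Longrightarrow> f (0, V) = b * integral\<^sup>L Q V"
    using scaled_minorant_eq_integral[OF \<rho>(2) XY(2) f2 ab(2)] le[OF zero] by auto
  have "0 \<le> a * integral\<^sup>L P U - b * integral\<^sup>L Q U" if "U \<in> D" for U
  proof -
    have U: "integrable M U" using that D(1) by auto
    have "f (U, - U) = f (U, 0) - f (0, U)"
      using linear_diff[OF f, of "(U, 0)" "(0, U)"] by simp
    then show ?thesis using ge[OF that] P(3)[OF U] Q(3)[OF U] by simp
  qed
  with P Q show ?thesis by blast
qed

section \<open>Existence of an optimal test\<close>

text \<open>
  The affine minorant of \<open>\<rho>\<close> at \<open>Z\<close> is the integral against a bounded density, to which dominated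
  convergence applies.
\<close>

lemma (in prob_space) dominated_lower_semicontinuous:
  assumes \<rho>: "convex_expectation M \<rho>" and K: "integrable M K"
    and X: "\<And>n. integrable M (X n)" "\<And>n. AE \<omega> in M. \<bar>X n \<omega>\<bar> \<le> K \<omega>" and Z: "integrable M Z"
    and lim: "AE \<omega> in M. (\<lambda>n. X n \<omega>) \<longlonglongrightarrow> Z \<omega>" and le: "\<And>n. \<rho> (X n) \<le> c"
  shows "\<rho> Z \<le> c"
proof -
  obtain P where P: "P \<in> finite_penalty_probs M \<rho>" and sub: "subgradient M \<rho> Z P"
    using subgradient_ex[OF \<rho> Z] by blast
  from P have P': "P \<in> ac_probs M" "bounded_density M P" by (auto simp: finite_penalty_probs_def)
  obtain G :: "'a \<Rightarrow> real" where [measurable]: "G \<in> borel_measurable M" and nn: "\<forall>\<omega>. 0 \<le> G \<omega>"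
    and int: "\<forall>X. integrable M X \<longrightarrow> integrable P X \<and> integrable M (\<lambda>\<omega>. G \<omega> * X \<omega>) \<and>
      integral\<^sup>L P X = (\<integral>\<omega>. G \<omega> * X \<omega> \<partial>M)"
    using bounded_density_integral[OF P'] by (elim exE conjE) (rule that; assumption)
  have "(\<lambda>n. \<integral>\<omega>. G \<omega> * (X n \<omega> - Z \<omega>) \<partial>M) \<longlonglongrightarrow> (\<integral>\<omega>. 0 \<partial>M)"
  proof (rule integral_dominated_convergence)
    show "integrable M (\<lambda>\<omega>. G \<omega> * (K \<omega> + \<bar>Z \<omega>\<bar>))" using K Z int by simp
    show "AE \<omega> in M. (\<lambda>n. G \<omega> * (X n \<omega> - Z \<omega>)) \<longlonglongrightarrow> 0"
      using lim by eventually_elim (intro tendsto_mult_right_zero LIM_zero)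
    show "AE \<omega> in M. norm (G \<omega> * (X n \<omega> - Z \<omega>)) \<le> G \<omega> * (K \<omega> + \<bar>Z \<omega>\<bar>)" for n
      using X(2)[of n]
    proof eventually_elim
      case (elim \<omega>)
      then have "G \<omega> * \<bar>X n \<omega> - Z \<omega>\<bar> \<le> G \<omega> * (K \<omega> + \<bar>Z \<omega>\<bar>)"
        by (intro mult_left_mono) (simp_all add: nn)
      then show ?case by (simp add: abs_mult nn)
    qed
  qed (use X Z in auto)
  then have "(\<lambda>n. \<rho> Z + (\<integral>\<omega>. X n \<omega> - Z \<omega> \<partial>P)) \<longlonglongrightarrow> \<rho> Z + 0"
    using X Z by (intro tendsto_add tendsto_const) (simp add: int right_diff_distrib)
  moreover have "\<rho> Z + (\<integral>\<omega>. X n \<omega> - Z \<omega> \<partial>P) \<le> c" for n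
    using sub X(1)[of n] le[of n] unfolding subgradient_def by (meson order_trans)
  ultimately show ?thesis by (simp add: LIMSEQ_le_const2)
qed

text \<open>
  This replaces weak compactness of order intervals in \<open>L\<^sup>1\<close>. After division by \<open>1 + K\<close> all functions
  are bounded by \<open>1\<close>, so their \<open>L\<^sup>2\<close> norms are finite. Elements of \<open>C n\<close> with nearly minimal
  weighted \<open>L\<^sup>2\<close> norm form a Cauchy sequence by the parallelogram identity, because the infima over the
  decreasing sets \<open>C n\<close> increase to a finite limit. A subsequence converges almost everywhere.
\<close>

lemma (in prob_space) nested_convex_sets_nonempty:
  fixes C :: "nat \<Rightarrow> ('a \<Rightarrow> real) set"
  assumes ne: "\<And>n. C n \<noteq> {}" and dec: "\<And>n. C (Suc n) \<subseteq> C n"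
    and K: "K \<in> borel_measurable M" and K_nn: "\<And>\<omega>. 0 \<le> K \<omega>"
    and C: "\<And>X. X \<in> C 0 \<Longrightarrow> X \<in> borel_measurable M" "\<And>X. X \<in> C 0 \<Longrightarrow> AE \<omega> in M. \<bar>X \<omega>\<bar> \<le> K \<omega>"
    and mid: "\<And>n X Y. X \<in> C n \<Longrightarrow> Y \<in> C n \<Longrightarrow> (\<lambda>\<omega>. (X \<omega> + Y \<omega>) / 2) \<in> C n"
    and closed: "\<And>n X Z. (\<And>i. X i \<in> C n) \<Longrightarrow> Z \<in> borel_measurable M \<Longrightarrow>
      AE \<omega> in M. (\<lambda>i. X i \<omega>) \<longlonglongrightarrow> Z \<omega> \<Longrightarrow> Z \<in> C n"
  shows "\<exists>Z. \<forall>n. Z \<in> C n"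
proof -
  have mono: "C n \<subseteq> C m" if "m \<le> n" for m n
    using dec that by (rule lift_Suc_antimono_le)
  have CK: "X \<in> borel_measurable M" "AE \<omega> in M. \<bar>X \<omega>\<bar> \<le> K \<omega>" if "X \<in> C n" for X n
    using C mono[of 0 n] that by auto
  note [measurable] = K
  define w where "w X \<omega> = X \<omega> / (1 + K \<omega>)" for X and \<omega> :: 'a
  define J where "J X = (\<integral>\<omega>. (w X \<omega>)\<^sup>2 \<partial>M)" for X
  have w_meas [measurable]: "w X \<in> borel_measurable M" if "X \<in> C n" for X n
    using CK(1)[OF that] unfolding w_def[abs_def] by measurable
  have w_le: "AE \<omega> in M. \<bar>w X \<omega>\<bar> \<le> 1" if "X \<in> C n" for X n
    using CK(2)[OF that]
  proof eventually_elim
    case (elim \<omega>)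
    then have "\<bar>X \<omega>\<bar> \<le> \<bar>1 + K \<omega>\<bar>" "1 + K \<omega> \<noteq> 0" using K_nn[of \<omega>] by linarith+
    then show ?case by (simp add: w_def)
  qed
  have w_int: "integrable M (w X)" if "X \<in> C n" for X n
    using w_meas[OF that] w_le[OF that] by (intro integrable_const_bound[of _ 1]) auto
  have sq_int: "integrable M (\<lambda>\<omega>. (w X \<omega>)\<^sup>2)" if "X \<in> C n" for X n
  proof (rule integrable_const_bound[of _ 1])
    show "AE \<omega> in M. norm ((w X \<omega>)\<^sup>2) \<le> 1"
      using w_le[OF that] by eventually_elim (simp add: abs_square_le_1)
  qed (use w_meas[OF that] in measurable)
  have J_nn: "0 \<le> J X" for X unfolding J_def by (intro integral_nonneg_AE) simp
  have J_le: "J X \<le> 1" if "X \<in> C n" for X n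
  proof -
    have "J X \<le> (\<integral>\<omega>. 1 \<partial>M)"
      unfolding J_def
      by (intro integral_mono_AE sq_int[OF that] integrable_const)
        (use w_le[OF that] in \<open>auto simp: abs_square_le_1\<close>)
    then show ?thesis by (simp add: prob_space)
  qed
  define m where "m n = (INF X\<in>C n. J X)" for n
  have m_le: "m n \<le> J X" if "X \<in> C n" for X n
    unfolding m_def using that J_nn by (intro cINF_lower bdd_belowI2)
  have "incseq m"
  proof (rule incseq_SucI)
    show "m n \<le> m (Suc n)" for n
      unfolding m_def using ne dec J_nn by (intro cINF_superset_mono bdd_belowI2) auto
  qed
  moreover have "m n \<le> 1" for n
    using ne[of n] m_le[of _ n] J_le[of _ n] by force
  ultimately obtain L where L: "m \<longlonglongrightarrow> L" "\<And>n. m n \<le> L"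
    using incseq_convergent by blast
  have "\<exists>X\<in>C n. J X < m n + 1 / real (Suc n)" for n
  proof -
    have "\<exists>y\<in>J ` C n. y < m n + 1 / real (Suc n)"
      unfolding m_def using ne[of n] J_nn
      by (intro cInf_lessD) auto
    then show ?thesis by auto
  qed
  then obtain Y where Y: "\<And>n. Y n \<in> C n" "\<And>n. J (Y n) < m n + 1 / real (Suc n)"
    by metis
  have near: "(\<integral>\<omega>. (w (Y i) \<omega> - w (Y j) \<omega>)\<^sup>2 \<partial>M) \<le> 4 * (L - m N) + 4 / real (Suc N)"
    if ij: "N \<le> i" "N \<le> j" for N i j
  proof -
    have YN: "Y i \<in> C N" "Y j \<in> C N" using Y(1) mono ij by blast+
    let ?V = "\<lambda>\<omega>. (Y i \<omega> + Y j \<omega>) / 2"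
    have V: "?V \<in> C N" by (rule mid[OF YN])
    have par: "(w (Y i) \<omega> - w (Y j) \<omega>)\<^sup>2 = 2 * (w (Y i) \<omega>)\<^sup>2 + 2 * (w (Y j) \<omega>)\<^sup>2 - 4 * (w ?V \<omega>)\<^sup>2" for \<omega>
    proof -
      have w_V: "w ?V \<omega> = (w (Y i) \<omega> + w (Y j) \<omega>) / 2"
        by (simp add: w_def add_divide_distrib mult.commute)
      show ?thesis unfolding w_V by (simp add: power2_eq_square field_simps)
    qed
    have "(\<integral>\<omega>. (w (Y i) \<omega> - w (Y j) \<omega>)\<^sup>2 \<partial>M) = 2 * J (Y i) + 2 * J (Y j) - 4 * J ?V"
      unfolding par J_def using sq_int[OF YN(1)] sq_int[OF YN(2)] sq_int[OF V] by simp
    moreover have "J (Y i) \<le> L + 1 / real (Suc N)" "J (Y j) \<le> L + 1 / real (Suc N)"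
    proof -
      have "J (Y k) \<le> L + 1 / real (Suc N)" if "N \<le> k" for k
      proof -
        have "1 / real (Suc k) \<le> 1 / real (Suc N)" using that by (simp add: frac_le)
        then show ?thesis using Y(2)[of k] L(2)[of k] by linarith
      qed
      then show "J (Y i) \<le> L + 1 / real (Suc N)" "J (Y j) \<le> L + 1 / real (Suc N)" using ij by auto
    qed
    ultimately show ?thesis using m_le[OF V] by argo
  qed
  have "(\<lambda>N. 4 * (L - m N) + 4 / real (Suc N)) \<longlonglongrightarrow> 4 * (L - L) + 0"
    by (intro tendsto_intros L(1) LIMSEQ_Suc[OF lim_const_over_n])
  then have small: "(\<lambda>N. 4 * (L - m N) + 4 / real (Suc N)) \<longlonglongrightarrow> 0" by simp
  have "\<exists>N. \<forall>i\<ge>N. \<forall>j\<ge>N. (\<integral>\<omega>. norm (w (Y i) \<omega> - w (Y j) \<omega>) \<partial>M) < e" if e: "0 < e" for e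
  proof -
    have "\<forall>\<^sub>F N in sequentially. 4 * (L - m N) + 4 / real (Suc N) < e\<^sup>2"
      using small e by (intro order_tendstoD) auto
    then obtain N where N: "4 * (L - m N) + 4 / real (Suc N) < e\<^sup>2"
      by (auto simp: eventually_sequentially)
    have "(\<integral>\<omega>. norm (w (Y i) \<omega> - w (Y j) \<omega>) \<partial>M) < e" if ij: "N \<le> i" "N \<le> j" for i j
    proof -
      let ?d = "\<lambda>\<omega>. w (Y i) \<omega> - w (Y j) \<omega>"
      have d_int: "integrable M (\<lambda>\<omega>. \<bar>?d \<omega>\<bar>)" 
        by (intro integrable_abs Bochner_Integration.integrable_diff w_int[OF Y(1)])
      have d2_int: "integrable M (\<lambda>\<omega>. (?d \<omega>)\<^sup>2)"
      proof (rule integrable_const_bound[of _ 4])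
        show "AE \<omega> in M. norm ((?d \<omega>)\<^sup>2) \<le> 4"
          using w_le[OF Y(1)[of i]] w_le[OF Y(1)[of j]]
        proof eventually_elim
          case (elim \<omega>)
          then have "\<bar>?d \<omega>\<bar> \<le> 2" by linarith
          then have "\<bar>?d \<omega>\<bar>\<^sup>2 \<le> 2\<^sup>2" by (intro power_mono) auto
          then show ?case by simp
        qed
      qed (use w_meas[OF Y(1)] in measurable)
      have "(\<integral>\<omega>. \<bar>?d \<omega>\<bar> \<partial>M) \<le> (\<integral>\<omega>. e / 2 + (?d \<omega>)\<^sup>2 / (2 * e) \<partial>M)"
      proof (intro integral_mono d_int)
        \<comment> \<open>this passes from the \<open>L\<^sup>2\<close> to the \<open>L\<^sup>1\<close> distance\<close>
        show "\<bar>?d \<omega>\<bar> \<le> e / 2 + (?d \<omega>)\<^sup>2 / (2 * e)" for \<omega>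
        proof -
          have "0 \<le> (\<bar>?d \<omega>\<bar> - e)\<^sup>2" by simp
          then have "2 * e * \<bar>?d \<omega>\<bar> \<le> e\<^sup>2 + (?d \<omega>)\<^sup>2"
            by (simp add: power2_diff algebra_simps)
          then show ?thesis using e by (simp add: field_simps power2_eq_square)
        qed
      qed (use d2_int in auto)
      also have "\<dots> = e / 2 + (\<integral>\<omega>. (?d \<omega>)\<^sup>2 \<partial>M) / (2 * e)"
        using d2_int by (simp add: prob_space)
      also have "\<dots> < e / 2 + e\<^sup>2 / (2 * e)"
        using near[OF ij] N e by (intro add_strict_left_mono divide_strict_right_mono) auto
      also have "\<dots> = e" using e by (simp add: power2_eq_square)
      finally show ?thesis by simp
    qed
    then show ?thesis by blast
  qed
  then obtain r where r: "strict_mono r" and cauchy: "AE \<omega> in M. Cauchy (\<lambda>i. w (Y (r i)) \<omega>)"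
    using cauchy_L1_AE_cauchy_subseq[of M "\<lambda>n. w (Y n)"] w_int[OF Y(1)] by blast
  define Z where "Z \<omega> = (1 + K \<omega>) * lim (\<lambda>i. w (Y (r i)) \<omega>)" for \<omega>
  have Z: "Z \<in> borel_measurable M"
    unfolding Z_def[abs_def]
    by (intro borel_measurable_times borel_measurable_lim_metric) (use w_meas[OF Y(1)] in auto)
  have lim: "AE \<omega> in M. (\<lambda>i. Y (r i) \<omega>) \<longlonglongrightarrow> Z \<omega>"
    using cauchy
  proof eventually_elim
    case (elim \<omega>)
    then have "(\<lambda>i. w (Y (r i)) \<omega>) \<longlonglongrightarrow> lim (\<lambda>i. w (Y (r i)) \<omega>)"
      by (simp only: Cauchy_convergent flip: convergent_LIMSEQ_iff)
    then have "(\<lambda>i. (1 + K \<omega>) * w (Y (r i)) \<omega>) \<longlonglongrightarrow> Z \<omega>"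
      unfolding Z_def by (intro tendsto_mult tendsto_const)
    moreover have "(1 + K \<omega>) * w (Y (r i)) \<omega> = Y (r i) \<omega>" for i
      using K_nn[of \<omega>] by (simp add: w_def)
    ultimately show ?case by simp
  qed
  have "Z \<in> C n" for n
  proof (rule closed)
    show "Y (r (i + n)) \<in> C n" for i
    proof -
      have "n \<le> r (i + n)" using seq_suble[OF r, of "i + n"] by simp
      then show ?thesis using Y(1) mono by blast
    qed
    show "AE \<omega> in M. (\<lambda>i. Y (r (i + n)) \<omega>) \<longlonglongrightarrow> Z \<omega>"
      using lim by eventually_elim (rule LIMSEQ_ignore_initial_segment)
  qed (rule Z)
  then show ?thesis by blast
qed

lemma optimal_test_iff:
  "optimal_test M \<rho>\<^sub>1 \<rho>\<^sub>2 K\<^sub>1 K\<^sub>2 \<alpha> X \<longleftrightarrow>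
     X \<in> tests M \<rho>\<^sub>1 K\<^sub>1 K\<^sub>2 \<alpha> \<and>
     (\<forall>Y\<in>tests M \<rho>\<^sub>1 K\<^sub>1 K\<^sub>2 \<alpha>. \<rho>\<^sub>2 (\<lambda>\<omega>. K\<^sub>2 \<omega> - X \<omega>) \<le> \<rho>\<^sub>2 (\<lambda>\<omega>. K\<^sub>2 \<omega> - Y \<omega>))"
  (is "?L \<longleftrightarrow> ?R")
proof
  assume L: ?L
  have "\<rho>\<^sub>2 (\<lambda>\<omega>. K\<^sub>2 \<omega> - X \<omega>) \<le> \<rho>\<^sub>2 (\<lambda>\<omega>. K\<^sub>2 \<omega> - Y \<omega>)"
    if "Y \<in> tests M \<rho>\<^sub>1 K\<^sub>1 K\<^sub>2 \<alpha>" for Y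
  proof -
    have "ereal (\<rho>\<^sub>2 (\<lambda>\<omega>. K\<^sub>2 \<omega> - X \<omega>)) \<le> ereal (\<rho>\<^sub>2 (\<lambda>\<omega>. K\<^sub>2 \<omega> - Y \<omega>))"
      using L that unfolding optimal_test_def by (auto intro: INF_lower)
    then show ?thesis by simp
  qed
  with L show ?R by (simp add: optimal_test_def)
next
  assume R: ?R
  then have "ereal (\<rho>\<^sub>2 (\<lambda>\<omega>. K\<^sub>2 \<omega> - X \<omega>)) \<le> (INF Y\<in>tests M \<rho>\<^sub>1 K\<^sub>1 K\<^sub>2 \<alpha>. ereal (\<rho>\<^sub>2 (\<lambda>\<omega>. K\<^sub>2 \<omega> - Y \<omega>)))"
    by (intro INF_greatest) simp
  moreover have "(INF Y\<in>tests M \<rho>\<^sub>1 K\<^sub>1 K\<^sub>2 \<alpha>. ereal (\<rho>\<^sub>2 (\<lambda>\<omega>. K\<^sub>2 \<omega> - Y \<omega>))) \<le> ereal (\<rho>\<^sub>2 (\<lambda>\<omega>. K\<^sub>2 \<omega> - X \<omega>))"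
    using R by (intro INF_lower) simp
  ultimately show ?L using R by (simp add: optimal_test_def)
qed

text \<open>
  The near-optimal tests form a decreasing sequence of convex sets that are closed under
  dominated convergence, as \<open>\<rho>\<^sub>1\<close> and \<open>\<rho>\<^sub>2\<close> are lower semicontinuous. An element of all of them is optimal.
\<close>

lemma (in prob_space) optimal_test_ex:
  assumes \<rho>: "convex_expectation M \<rho>\<^sub>1" "convex_expectation M \<rho>\<^sub>2"
    and K: "integrable M K\<^sub>1" "integrable M K\<^sub>2"
    and le: "AE \<omega> in M. K\<^sub>1 \<omega> \<le> K\<^sub>2 \<omega>" and ne: "\<rho>\<^sub>1 K\<^sub>1 \<le> \<alpha>"
  shows "\<exists>X. optimal_test M \<rho>\<^sub>1 \<rho>\<^sub>2 K\<^sub>1 K\<^sub>2 \<alpha> X"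
proof -
  let ?T = "tests M \<rho>\<^sub>1 K\<^sub>1 K\<^sub>2 \<alpha>" and ?\<phi> = "\<lambda>X. \<rho>\<^sub>2 (\<lambda>\<omega>. K\<^sub>2 \<omega> - X \<omega>)"
  define K where "K \<omega> = \<bar>K\<^sub>1 \<omega>\<bar> + \<bar>K\<^sub>2 \<omega>\<bar>" for \<omega>
  have K_int: "integrable M K" using K by (simp add: K_def[abs_def])
  have K1: "K\<^sub>1 \<in> ?T" using K le ne by (simp add: tests_def)
  have T: "integrable M X" "AE \<omega> in M. K\<^sub>1 \<omega> \<le> X \<omega> \<and> X \<omega> \<le> K\<^sub>2 \<omega>" "\<rho>\<^sub>1 X \<le> \<alpha>" if "X \<in> ?T" for X
    using that by (auto simp: tests_def)
  have T_le: "AE \<omega> in M. \<bar>X \<omega>\<bar> \<le> K \<omega>" if "X \<in> ?T" for X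
    using T(2)[OF that] by eventually_elim (auto simp: K_def)
  have low: "\<rho>\<^sub>2 (\<lambda>\<omega>. 0) \<le> ?\<phi> X" if "X \<in> ?T" for X
    using T[OF that] K by (intro convex_expectation_mono[OF \<rho>(2)]) auto
  define v where "v = (INF X\<in>?T. ?\<phi> X)"
  have v_le: "v \<le> ?\<phi> X" if "X \<in> ?T" for X
    unfolding v_def using that low by (intro cINF_lower bdd_belowI2)
  define C where "C n = {X \<in> ?T. ?\<phi> X \<le> v + 1 / real (Suc n)}" for n
  have CT: "X \<in> ?T" if "X \<in> C n" for X n using that by (simp add: C_def)
  have "\<exists>Z. \<forall>n. Z \<in> C n"
  proof (rule nested_convex_sets_nonempty)
    show "C n \<noteq> {}" for n
    proof -
      have "\<exists>y\<in>?\<phi> ` ?T. y < v + 1 / real (Suc n)"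
        unfolding v_def using K1 by (intro cInf_lessD) auto
      then show ?thesis by (auto simp: C_def)
    qed
    show "C (Suc n) \<subseteq> C n" for n
    proof -
      have "1 / real (Suc (Suc n)) \<le> 1 / real (Suc n)" by (simp add: frac_le)
      then show ?thesis unfolding C_def by auto
    qed
    show "K \<in> borel_measurable M" "\<And>\<omega>. 0 \<le> K \<omega>" using K_int by (auto simp: K_def)
    show "X \<in> borel_measurable M" "AE \<omega> in M. \<bar>X \<omega>\<bar> \<le> K \<omega>" if "X \<in> C 0" for X
      using T(1)[OF CT[OF that]] T_le[OF CT[OF that]] by auto
  next
    fix n X Y assume XY: "X \<in> C n" "Y \<in> C n"
    note X = T[OF CT[OF XY(1)]] and Y = T[OF CT[OF XY(2)]]
    let ?V = "\<lambda>\<omega>. (X \<omega> + Y \<omega>) / 2"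
    have "\<rho>\<^sub>1 (\<lambda>\<omega>. (1 / 2) * X \<omega> + (1 / 2) * Y \<omega>) \<le> (1 / 2) * \<rho>\<^sub>1 X + (1 / 2) * \<rho>\<^sub>1 Y"
      by (rule convex_expectation_convex[OF \<rho>(1) X(1) Y(1)]) auto
    then have "\<rho>\<^sub>1 ?V \<le> \<alpha>" using X(3) Y(3) by (simp add: add_divide_distrib)
    moreover have "AE \<omega> in M. K\<^sub>1 \<omega> \<le> ?V \<omega> \<and> ?V \<omega> \<le> K\<^sub>2 \<omega>"
      using X(2) Y(2) by eventually_elim auto
    moreover have "\<rho>\<^sub>2 (\<lambda>\<omega>. (1 / 2) * (K\<^sub>2 \<omega> - X \<omega>) + (1 / 2) * (K\<^sub>2 \<omega> - Y \<omega>))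
        \<le> (1 / 2) * ?\<phi> X + (1 / 2) * ?\<phi> Y"
      using K X Y by (intro convex_expectation_convex[OF \<rho>(2)]) auto
    moreover have "(\<lambda>\<omega>. (1 / 2) * (K\<^sub>2 \<omega> - X \<omega>) + (1 / 2) * (K\<^sub>2 \<omega> - Y \<omega>)) = (\<lambda>\<omega>. K\<^sub>2 \<omega> - ?V \<omega>)"
      by (simp add: fun_eq_iff field_simps)
    ultimately show "?V \<in> C n"
      using X(1) Y(1) XY by (simp add: C_def tests_def)
  next
    fix n X Z
    assume X: "\<And>i. X i \<in> C n" and Z: "Z \<in> borel_measurable M"
      and lim: "AE \<omega> in M. (\<lambda>i. X i \<omega>) \<longlonglongrightarrow> Z \<omega>"
    note XT = T[OF CT[OF X]] T_le[OF CT[OF X]]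
    have "AE \<omega> in M. \<forall>i. K\<^sub>1 \<omega> \<le> X i \<omega> \<and> X i \<omega> \<le> K\<^sub>2 \<omega>"
      using XT(2) by (simp add: AE_all_countable)
    then have Z_bd: "AE \<omega> in M. K\<^sub>1 \<omega> \<le> Z \<omega> \<and> Z \<omega> \<le> K\<^sub>2 \<omega>"
      using lim by eventually_elim (auto intro: LIMSEQ_le_const LIMSEQ_le_const2)
    then have Z_int: "integrable M Z"
      by (intro Bochner_Integration.integrable_bound[OF K_int Z]) (auto simp: K_def)
    have "\<rho>\<^sub>1 Z \<le> \<alpha>"
      by (rule dominated_lower_semicontinuous[OF \<rho>(1) K_int XT(1) XT(4) Z_int lim XT(3)])
    moreover have "?\<phi> Z \<le> v + 1 / real (Suc n)"
    proof (rule dominated_lower_semicontinuous[OF \<rho>(2), where K = "\<lambda>\<omega>. K \<omega> + \<bar>K\<^sub>2 \<omega>\<bar>"])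
      show "AE \<omega> in M. \<bar>K\<^sub>2 \<omega> - X i \<omega>\<bar> \<le> K \<omega> + \<bar>K\<^sub>2 \<omega>\<bar>" for i
        using XT(4)[of i] by eventually_elim auto
      show "AE \<omega> in M. (\<lambda>i. K\<^sub>2 \<omega> - X i \<omega>) \<longlonglongrightarrow> K\<^sub>2 \<omega> - Z \<omega>"
        using lim by eventually_elim (intro tendsto_diff tendsto_const)
      show "?\<phi> (X i) \<le> v + 1 / real (Suc n)" for i using X[of i] by (simp add: C_def)
    qed (use K K_int XT Z_int in auto)
    ultimately show "Z \<in> C n" using Z_int Z_bd by (simp add: C_def tests_def)
  qed
  then obtain Z where Z: "\<And>n. Z \<in> C n" by blast
  have "?\<phi> Z \<le> v"
  proof (rule field_le_epsilon)
    fix e :: real assume "0 < e"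
    then obtain n where "inverse (real (Suc n)) < e" using reals_Archimedean by blast
    then show "?\<phi> Z \<le> v + e" using Z[of n] by (simp add: C_def inverse_eq_divide)
  qed
  then have "optimal_test M \<rho>\<^sub>1 \<rho>\<^sub>2 K\<^sub>1 K\<^sub>2 \<alpha> Z"
    unfolding optimal_test_iff using CT[OF Z] v_le by (meson order_trans)
  then show ?thesis by blast
qed

section \<open>Multipliers and the bang-bang form of optimal tests\<close>

text \<open>
  Multipliers without a constraint qualification: the set of all \<open>(s, t)\<close> that strictly dominate some
  \<open>(\<phi> x, \<psi> x)\<close> is convex and misses the origin, so a line separates them. The price for having no
  qualification is that the multiplier \<open>b\<close> of the objective may vanish; this is the case \<open>z = \<infinity>\<close> of the
  theorem.
\<close>

lemma convex_fritz_john: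
  assumes \<phi>: "convex_on S \<phi>" and \<psi>: "convex_on S \<psi>" and ne: "S \<noteq> {}"
    and infeasible: "\<And>x. x \<in> S \<Longrightarrow> \<phi> x < 0 \<Longrightarrow> 0 \<le> \<psi> x"
  shows "\<exists>a b. 0 \<le> a \<and> 0 \<le> b \<and> (a, b) \<noteq> (0, 0) \<and> (\<forall>x\<in>S. 0 \<le> a * \<phi> x + b * \<psi> x)"
proof -
  define A where "A = {(s, t). \<exists>x\<in>S. \<phi> x < s \<and> \<psi> x < (t::real)}"
  have "convex A"
  proof (rule convexI)
    fix p q and u v :: real assume pq: "p \<in> A" "q \<in> A" and uv: "0 \<le> u" "0 \<le> v" "u + v = 1"
    obtain s t s' t' where st: "p = (s, t)" "q = (s', t')" by (cases p, cases q)
    obtain x y where x: "x \<in> S" "\<phi> x < s" "\<psi> x < t" and y: "y \<in> S" "\<phi> y < s'" "\<psi> y < t'"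
      using pq st by (auto simp: A_def)
    have comb: "u * c + v * d < u * c' + v * d'" if "c < c'" "d < d'" for c d c' d' :: real
      using that uv by (smt (verit) mult_left_mono mult_strict_left_mono)
    have "u *\<^sub>R x + v *\<^sub>R y \<in> S"
      using \<phi> x y uv by (auto simp: convex_on_def convex_def)
    moreover have "\<phi> (u *\<^sub>R x + v *\<^sub>R y) < u * s + v * s'"
      using \<phi> x y uv comb[OF x(2) y(2)] unfolding convex_on_def by (meson le_less_trans)
    moreover have "\<psi> (u *\<^sub>R x + v *\<^sub>R y) < u * t + v * t'"
      using \<psi> x y uv comb[OF x(3) y(3)] unfolding convex_on_def by (meson le_less_trans)
    ultimately show "u *\<^sub>R p + v *\<^sub>R q \<in> A" by (auto simp: A_def st)
  qed
  moreover have "0 \<notin> A"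
  proof
    assume "0 \<in> A"
    then obtain x where "x \<in> S" "\<phi> x < 0" "\<psi> x < 0" by (auto simp: A_def zero_prod_def)
    with infeasible[of x] show False by simp
  qed
  ultimately have "\<exists>c. c \<noteq> 0 \<and> (\<forall>p\<in>A. 0 \<le> inner c p)"
    by (rule separating_hyperplane_set_0)
  then obtain c where c: "c \<noteq> 0" "\<And>p. p \<in> A \<Longrightarrow> 0 \<le> inner c p" by auto
  obtain a b where ab: "c = (a, b)" by (cases c)
  have ge: "0 \<le> a * s + b * t" if "x \<in> S" "\<phi> x < s" "\<psi> x < t" for x s t
  proof -
    have "(s, t) \<in> A" using that by (auto simp: A_def)
    then show ?thesis using c(2)[of "(s, t)"] by (simp add: ab)
  qed
  have ge': "0 \<le> a * (\<phi> x + s) + b * (\<psi> x + t)" if "x \<in> S" "0 < s" "0 < t" for x s t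
    by (rule ge[OF that(1)]) (use that in simp_all)
  have lim: "0 \<le> d" if "\<And>s::real. 0 < s \<Longrightarrow> 0 \<le> d + s * k" for d k :: real
  proof (rule field_le_epsilon)
    fix e :: real assume "0 < e"
    then have "0 \<le> d + e / (1 + \<bar>k\<bar>) * k" by (intro that) simp
    moreover have "e / (1 + \<bar>k\<bar>) * k \<le> e" using \<open>0 < e\<close>
      by (simp add: field_simps) (smt (verit) mult_left_mono)
    ultimately show "0 \<le> d + e" by simp
  qed
  obtain x where x: "x \<in> S" using ne by blast
  have "0 \<le> a"
  proof (rule lim)
    fix s :: real assume "0 < s"
    then have "0 \<le> s * (a * (\<phi> x + 1 / s) + b * (\<psi> x + 1))"
      using ge'[OF x, of "1 / s" 1] by simp
    then show "0 \<le> a + s * (a * \<phi> x + b * (\<psi> x + 1))" using \<open>0 < s\<close> by (simp add: algebra_simps)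
  qed
  moreover have "0 \<le> b"
  proof (rule lim)
    fix s :: real assume "0 < s"
    then have "0 \<le> s * (a * (\<phi> x + 1) + b * (\<psi> x + 1 / s))"
      using ge'[OF x, of 1 "1 / s"] by simp
    then show "0 \<le> b + s * (a * (\<phi> x + 1) + b * \<psi> x)" using \<open>0 < s\<close> by (simp add: algebra_simps)
  qed
  moreover have "0 \<le> a * \<phi> y + b * \<psi> y" if "y \<in> S" for y
  proof (rule lim)
    fix s :: real assume "0 < s"
    then show "0 \<le> (a * \<phi> y + b * \<psi> y) + s * (a + b)"
      using ge'[OF that, of s s] by (simp add: algebra_simps)
  qed
  ultimately show ?thesis using c(1) ab by (auto simp: zero_prod_def)
qed

definition order_interval :: "'a measure \<Rightarrow> ('a \<Rightarrow> real) \<Rightarrow> ('a \<Rightarrow> real) \<Rightarrow> ('a \<Rightarrow> real) set" where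
  "order_interval M K L = {X. integrable M X \<and> (AE \<omega> in M. K \<omega> \<le> X \<omega> \<and> X \<omega> \<le> L \<omega>)}"

lemma convex_order_interval: "convex (order_interval M K L)"
proof (rule convexI)
  fix X Y and u v :: real
  assume XY: "X \<in> order_interval M K L" "Y \<in> order_interval M K L" and uv: "0 \<le> u" "0 \<le> v" "u + v = 1"
  have "AE \<omega> in M. K \<omega> \<le> X \<omega> \<and> X \<omega> \<le> L \<omega>" "AE \<omega> in M. K \<omega> \<le> Y \<omega> \<and> Y \<omega> \<le> L \<omega>"
    using XY by (auto simp: order_interval_def)
  then have "AE \<omega> in M. K \<omega> \<le> u * X \<omega> + v * Y \<omega> \<and> u * X \<omega> + v * Y \<omega> \<le> L \<omega>"
  proof eventually_elim
    case (elim \<omega>)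
    then have "u *\<^sub>R X \<omega> + v *\<^sub>R Y \<omega> \<in> {K \<omega>..L \<omega>}"
      using uv by (intro convexD[OF convex_real_interval(5)]) auto
    then show ?case by simp
  qed
  then show "u *\<^sub>R X + v *\<^sub>R Y \<in> order_interval M K L"
    using XY by (auto simp: order_interval_def plus_fun_def scaleR_fun_def)
qed

text \<open>
  The integrand is smallest when the function takes the upper end of the interval where \<open>\<theta>\<close> is
  negative and the lower end where \<open>\<theta>\<close> is positive. A minimizer can differ from that choice only on a
  null set.
\<close>

lemma order_interval_minimizer_bang_bang:
  fixes \<theta> X K L :: "'a \<Rightarrow> real"
  assumes \<theta> [measurable]: "\<theta> \<in> borel_measurable M" and KL: "integrable M K" "integrable M L"
    and X: "integrable M X" "AE \<omega> in M. K \<omega> \<le> X \<omega> \<and> X \<omega> \<le> L \<omega>"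
    and int: "\<And>Y. integrable M Y \<Longrightarrow> integrable M (\<lambda>\<omega>. \<theta> \<omega> * Y \<omega>)"
    and min: "\<And>Y. integrable M Y \<Longrightarrow> AE \<omega> in M. K \<omega> \<le> Y \<omega> \<and> Y \<omega> \<le> L \<omega> \<Longrightarrow>
      (\<integral>\<omega>. \<theta> \<omega> * X \<omega> \<partial>M) \<le> (\<integral>\<omega>. \<theta> \<omega> * Y \<omega> \<partial>M)"
  shows "AE \<omega> in M. (\<theta> \<omega> < 0 \<longrightarrow> X \<omega> = L \<omega>) \<and> (0 < \<theta> \<omega> \<longrightarrow> X \<omega> = K \<omega>)"
proof -
  have [measurable]: "K \<in> borel_measurable M" "L \<in> borel_measurable M" "X \<in> borel_measurable M"
    using KL X by auto
  define Y where "Y \<omega> = (if \<theta> \<omega> < 0 then L \<omega> else if 0 < \<theta> \<omega> then K \<omega> else X \<omega>)" for \<omega>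
  have Y_meas: "Y \<in> borel_measurable M" unfolding Y_def[abs_def] by measurable
  have Y: "integrable M Y"
  proof (rule Bochner_Integration.integrable_bound[OF _ Y_meas])
    show "integrable M (\<lambda>\<omega>. \<bar>K \<omega>\<bar> + \<bar>L \<omega>\<bar>)" using KL by simp
    show "AE \<omega> in M. norm (Y \<omega>) \<le> norm (\<bar>K \<omega>\<bar> + \<bar>L \<omega>\<bar>)"
      using X(2) by eventually_elim (auto simp: Y_def)
  qed
  have "AE \<omega> in M. K \<omega> \<le> Y \<omega> \<and> Y \<omega> \<le> L \<omega>"
    using X(2) by eventually_elim (auto simp: Y_def)
  then have "(\<integral>\<omega>. \<theta> \<omega> * X \<omega> \<partial>M) \<le> (\<integral>\<omega>. \<theta> \<omega> * Y \<omega> \<partial>M)" by (rule min[OF Y])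
  then have le: "(\<integral>\<omega>. \<theta> \<omega> * (X \<omega> - Y \<omega>) \<partial>M) \<le> 0"
    using int[OF X(1)] int[OF Y] by (simp add: right_diff_distrib)
  have nn: "AE \<omega> in M. 0 \<le> \<theta> \<omega> * (X \<omega> - Y \<omega>)"
    using X(2) by eventually_elim (auto simp: Y_def zero_le_mult_iff)
  have "(\<integral>\<omega>. \<theta> \<omega> * (X \<omega> - Y \<omega>) \<partial>M) = 0"
    using le integral_nonneg_AE[OF nn] by simp
  then have "AE \<omega> in M. \<theta> \<omega> * (X \<omega> - Y \<omega>) = 0"
    using nn int[of "\<lambda>\<omega>. X \<omega> - Y \<omega>"] X(1) Y by (simp add: integral_nonneg_eq_0_iff_AE)
  then show ?thesis
    by eventually_elim (auto simp: Y_def split: if_splits)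
qed

text \<open>
  With \<open>z = a / b\<close>, the sign of \<open>a * G - b * H\<close> decides between \<open>H < z * G\<close> and \<open>H > z * G\<close>. For
  \<open>b = 0\<close> it is the sign of \<open>G\<close>, which is the convention for \<open>z = \<infinity>\<close>. On the region of equality
  nothing is known, and the function itself takes the part of \<open>B\<close>.
\<close>

lemma bang_bang_imp_density_regions:
  fixes G H K\<^sub>1 K\<^sub>2 X :: "'a \<Rightarrow> real"
  assumes ab: "0 \<le> a" "0 \<le> b" "(a, b) \<noteq> (0, 0)"
    and G: "AE \<omega> in M. RN_deriv M P \<omega> = ennreal (G \<omega>)" "\<forall>\<omega>. 0 \<le> G \<omega>"
    and H: "AE \<omega> in M. RN_deriv M Q \<omega> = ennreal (H \<omega>)" "\<forall>\<omega>. 0 \<le> H \<omega>"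
    and X: "AE \<omega> in M. (a * G \<omega> - b * H \<omega> < 0 \<longrightarrow> X \<omega> = K\<^sub>2 \<omega>) \<and> (0 < a * G \<omega> - b * H \<omega> \<longrightarrow> X \<omega> = K\<^sub>1 \<omega>)"
  defines "z \<equiv> if b = 0 then \<infinity> else ennreal (a / b)"
  shows "AE \<omega> in M. X \<omega> =
    K\<^sub>2 \<omega> * indicator (density_above M Q P z) \<omega> +
    X \<omega> * indicator (density_equal M Q P z) \<omega> +
    K\<^sub>1 \<omega> * indicator (density_below M Q P z) \<omega>"
  using G(1) H(1) X AE_space
proof eventually_elim
  case (elim \<omega>)
  show ?case
  proof (cases "b = 0")
    case True
    with ab have "0 < a" by auto
    moreover have "0 \<le> G \<omega>" using G(2) by simp
    ultimately show ?thesis using True elim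
      by (cases "G \<omega> = 0") (auto simp: z_def density_above_def density_equal_def density_below_def indicator_def)
  next
    case False
    with ab have b: "0 < b" by auto
    have "ennreal (a / b) * RN_deriv M P \<omega> = ennreal (a / b * G \<omega>)"
      using elim(1) ab(1) b G(2) by (subst ennreal_mult) auto
    moreover have "H \<omega> < a / b * G \<omega> \<longleftrightarrow> 0 < a * G \<omega> - b * H \<omega>"
        "a / b * G \<omega> < H \<omega> \<longleftrightarrow> a * G \<omega> - b * H \<omega> < 0"
      using b by (auto simp: field_simps)
    moreover have "0 \<le> a / b * G \<omega>" using ab(1) b G(2) by simp
    ultimately show ?thesis
      using elim H(2) False
      by (cases "H \<omega>" "a / b * G \<omega>" rule: linorder_cases)
        (auto simp: z_def density_above_def density_equal_def density_below_def indicator_def ennreal_less_iff)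
  qed
qed

text \<open>
  The measures and the multipliers are obtained at one optimal test \<open>X\<^sub>0\<close> and serve for all others.
\<close>

theorem theorem6p4:
  fixes M :: "'a measure"
    and \<rho>\<^sub>1 \<rho>\<^sub>2 :: "('a \<Rightarrow> real) \<Rightarrow> real"
    and K\<^sub>1 K\<^sub>2 :: "'a \<Rightarrow> real"
    and \<alpha> :: real
  assumes "prob_space M"
    and "convex_expectation M \<rho>\<^sub>1" and "convex_expectation M \<rho>\<^sub>2"
    and "integrable M K\<^sub>1" and "integrable M K\<^sub>2"
    and "AE \<omega> in M. 0 \<le> K\<^sub>1 \<omega>" and "AE \<omega> in M. K\<^sub>1 \<omega> < K\<^sub>2 \<omega>"
    and "\<rho>\<^sub>1 K\<^sub>1 \<le> \<alpha>" and "\<alpha> \<le> \<rho>\<^sub>1 K\<^sub>2"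
  shows "(\<exists>X. optimal_test M \<rho>\<^sub>1 \<rho>\<^sub>2 K\<^sub>1 K\<^sub>2 \<alpha> X) \<and>
    (\<exists>P\<in>finite_penalty_probs M \<rho>\<^sub>1. \<exists>Q\<in>finite_penalty_probs M \<rho>\<^sub>2.
       \<forall>X. optimal_test M \<rho>\<^sub>1 \<rho>\<^sub>2 K\<^sub>1 K\<^sub>2 \<alpha> X \<longrightarrow>
         (\<exists>z::ennreal. \<exists>B\<in>borel_measurable M.
            (AE \<omega> in M. K\<^sub>1 \<omega> \<le> B \<omega> \<and> B \<omega> \<le> K\<^sub>2 \<omega>) \<and>
            (AE \<omega> in M. X \<omega> =
               K\<^sub>2 \<omega> * indicator (density_above M Q P z) \<omega> +
               B \<omega> * indicator (density_equal M Q P z) \<omega> +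
               K\<^sub>1 \<omega> * indicator (density_below M Q P z) \<omega>)))"
proof (intro conjI)
  interpret prob_space M by fact
  note \<rho> = assms(2,3) and K = assms(4,5)
  have K_le: "AE \<omega> in M. K\<^sub>1 \<omega> \<le> K\<^sub>2 \<omega>" using assms(7) by auto
  show ex: "\<exists>X. optimal_test M \<rho>\<^sub>1 \<rho>\<^sub>2 K\<^sub>1 K\<^sub>2 \<alpha> X"
    by (rule optimal_test_ex[OF \<rho> K K_le assms(8)])
  then obtain X\<^sub>0 where opt: "optimal_test M \<rho>\<^sub>1 \<rho>\<^sub>2 K\<^sub>1 K\<^sub>2 \<alpha> X\<^sub>0" by blast
  let ?S = "order_interval M K\<^sub>1 K\<^sub>2" and ?\<phi> = "\<lambda>X. \<rho>\<^sub>2 (\<lambda>\<omega>. K\<^sub>2 \<omega> - X \<omega>)"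
  have tests: "X \<in> tests M \<rho>\<^sub>1 K\<^sub>1 K\<^sub>2 \<alpha> \<longleftrightarrow> X \<in> ?S \<and> \<rho>\<^sub>1 X \<le> \<alpha>" for X
    by (auto simp: tests_def order_interval_def)
  have X0: "X\<^sub>0 \<in> ?S" "integrable M X\<^sub>0" "\<rho>\<^sub>1 X\<^sub>0 \<le> \<alpha>"
    using opt by (auto simp: optimal_test_iff tests_def order_interval_def)
  have S_int: "?S \<subseteq> {X. integrable M X}" by (auto simp: order_interval_def)
  have "\<exists>a b. 0 \<le> a \<and> 0 \<le> b \<and> (a, b) \<noteq> (0, 0) \<and> (\<forall>X\<in>?S. 0 \<le> a * (\<rho>\<^sub>1 X - \<alpha>) + b * (?\<phi> X - ?\<phi> X\<^sub>0))"
  proof (rule convex_fritz_john)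
    show "convex_on ?S (\<lambda>X. \<rho>\<^sub>1 X - \<alpha>)"
      using convex_on_subset[OF convex_on_affine_expectation[OF \<rho>(1), of "\<lambda>_. 0" 1 \<alpha>] S_int convex_order_interval]
      by simp
    show "convex_on ?S (\<lambda>X. ?\<phi> X - ?\<phi> X\<^sub>0)"
      using convex_on_subset[OF convex_on_affine_expectation[OF \<rho>(2) K(2), of "-1" "?\<phi> X\<^sub>0"] S_int convex_order_interval]
      by simp
    show "?S \<noteq> {}" using X0(1) by blast
    show "0 \<le> ?\<phi> X - ?\<phi> X\<^sub>0" if "X \<in> ?S" "\<rho>\<^sub>1 X - \<alpha> < 0" for X
      using opt that by (simp add: optimal_test_iff tests)
  qed
  then obtain a b where ab: "0 \<le> a" "0 \<le> b" "(a, b) \<noteq> (0, 0)"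
    and mult: "\<And>X. X \<in> ?S \<Longrightarrow> 0 \<le> a * (\<rho>\<^sub>1 X - \<alpha>) + b * (?\<phi> X - ?\<phi> X\<^sub>0)" by blast
  \<comment> \<open>complementary slackness, for every optimal test\<close>
  have slack: "a * \<rho>\<^sub>1 X = a * \<alpha>" "?\<phi> X = ?\<phi> X\<^sub>0" if "optimal_test M \<rho>\<^sub>1 \<rho>\<^sub>2 K\<^sub>1 K\<^sub>2 \<alpha> X" for X
  proof -
    have X: "X \<in> ?S" "\<rho>\<^sub>1 X \<le> \<alpha>" using that by (auto simp: optimal_test_iff tests)
    show "?\<phi> X = ?\<phi> X\<^sub>0"
      using that opt by (intro antisym) (auto simp: optimal_test_iff)
    then have "0 \<le> a * (\<rho>\<^sub>1 X - \<alpha>)" using mult[OF X(1)] by simp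
    moreover have "a * (\<rho>\<^sub>1 X - \<alpha>) \<le> 0" using ab(1) X(2) by (simp add: mult_nonneg_nonpos)
    ultimately show "a * \<rho>\<^sub>1 X = a * \<alpha>" by (simp add: right_diff_distrib)
  qed
  let ?D = "order_interval M (\<lambda>\<omega>. K\<^sub>1 \<omega> - X\<^sub>0 \<omega>) (\<lambda>\<omega>. K\<^sub>2 \<omega> - X\<^sub>0 \<omega>)"
  have "\<exists>P\<in>finite_penalty_probs M \<rho>\<^sub>1. \<exists>Q\<in>finite_penalty_probs M \<rho>\<^sub>2.
    subgradient M \<rho>\<^sub>1 X\<^sub>0 P \<and> subgradient M \<rho>\<^sub>2 (\<lambda>\<omega>. K\<^sub>2 \<omega> - X\<^sub>0 \<omega>) Q \<and>
    (\<forall>U\<in>?D. 0 \<le> a * integral\<^sup>L P U - b * integral\<^sup>L Q U)"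
  proof (rule joint_subgradients[OF \<rho> X0(2) _ ab(1,2) _ convex_order_interval])
    show "0 \<in> ?D" using X0(1) by (auto simp: order_interval_def zero_fun_def)
    fix U assume U: "U \<in> ?D"
    have "(\<lambda>\<omega>. X\<^sub>0 \<omega> + U \<omega>) \<in> ?S"
      using U X0(2) by (auto simp: order_interval_def algebra_simps)
    then show "0 \<le> a * (\<rho>\<^sub>1 (\<lambda>\<omega>. X\<^sub>0 \<omega> + U \<omega>) - \<rho>\<^sub>1 X\<^sub>0) +
        b * (\<rho>\<^sub>2 (\<lambda>\<omega>. K\<^sub>2 \<omega> - X\<^sub>0 \<omega> - U \<omega>) - ?\<phi> X\<^sub>0)"
      using mult[of "\<lambda>\<omega>. X\<^sub>0 \<omega> + U \<omega>"] slack(1)[OF opt]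
      by (auto simp: right_diff_distrib diff_diff_eq)
  qed (use K X0(2) in \<open>auto simp: order_interval_def\<close>)
  then obtain P Q where P: "P \<in> finite_penalty_probs M \<rho>\<^sub>1" "subgradient M \<rho>\<^sub>1 X\<^sub>0 P"
    and Q: "Q \<in> finite_penalty_probs M \<rho>\<^sub>2" "subgradient M \<rho>\<^sub>2 (\<lambda>\<omega>. K\<^sub>2 \<omega> - X\<^sub>0 \<omega>) Q"
    and normal: "\<And>U. U \<in> ?D \<Longrightarrow> 0 \<le> a * integral\<^sup>L P U - b * integral\<^sup>L Q U" by blast
  have P': "P \<in> ac_probs M" "bounded_density M P" and Q': "Q \<in> ac_probs M" "bounded_density M Q"
    using P(1) Q(1) by (auto simp: finite_penalty_probs_def)
  obtain G where G: "G \<in> borel_measurable M"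
      "AE \<omega> in M. RN_deriv M P \<omega> = ennreal (G \<omega>)" "\<forall>\<omega>. 0 \<le> G \<omega>"
      "\<forall>X. integrable M X \<longrightarrow> integrable P X \<and> integrable M (\<lambda>\<omega>. G \<omega> * X \<omega>) \<and>
        integral\<^sup>L P X = (\<integral>\<omega>. G \<omega> * X \<omega> \<partial>M)"
    using bounded_density_integral[OF P'] by (elim exE conjE) (rule that)
  obtain H where H: "H \<in> borel_measurable M"
      "AE \<omega> in M. RN_deriv M Q \<omega> = ennreal (H \<omega>)" "\<forall>\<omega>. 0 \<le> H \<omega>"
      "\<forall>X. integrable M X \<longrightarrow> integrable Q X \<and> integrable M (\<lambda>\<omega>. H \<omega> * X \<omega>) \<and>
        integral\<^sup>L Q X = (\<integral>\<omega>. H \<omega> * X \<omega> \<partial>M)"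
    using bounded_density_integral[OF Q'] by (elim exE conjE) (rule that)
  define \<theta> where "\<theta> \<omega> = a * G \<omega> - b * H \<omega>" for \<omega>
  have \<theta>_mult: "\<theta> \<omega> * X \<omega> = a * (G \<omega> * X \<omega>) - b * (H \<omega> * X \<omega>)" for X \<omega>
    by (simp add: \<theta>_def algebra_simps)
  have \<theta>_int: "integrable M (\<lambda>\<omega>. \<theta> \<omega> * X \<omega>)" if "integrable M X" for X
    unfolding \<theta>_mult using G(4) H(4) that by simp
  have \<theta>_eq: "(\<integral>\<omega>. \<theta> \<omega> * X \<omega> \<partial>M) = a * integral\<^sup>L P X - b * integral\<^sup>L Q X" if "integrable M X" for X
    unfolding \<theta>_mult using G(4) H(4) that by simp
  have \<theta>_diff: "(\<integral>\<omega>. \<theta> \<omega> * Y \<omega> \<partial>M) = (\<integral>\<omega>. \<theta> \<omega> * X\<^sub>0 \<omega> \<partial>M)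
      + (a * (\<integral>\<omega>. Y \<omega> - X\<^sub>0 \<omega> \<partial>P) - b * (\<integral>\<omega>. Y \<omega> - X\<^sub>0 \<omega> \<partial>Q))" if "integrable M Y" for Y
    using \<theta>_eq[of "\<lambda>\<omega>. Y \<omega> - X\<^sub>0 \<omega>"] \<theta>_int[OF that] \<theta>_int[OF X0(2)] that X0(2)
    by (simp add: right_diff_distrib)
  \<comment> \<open>\<open>X\<^sub>0\<close> minimizes the linearized cost over the whole order interval\<close>
  have X0_min: "(\<integral>\<omega>. \<theta> \<omega> * X\<^sub>0 \<omega> \<partial>M) \<le> (\<integral>\<omega>. \<theta> \<omega> * Y \<omega> \<partial>M)" if "Y \<in> ?S" for Y
  proof -
    have Y: "integrable M Y" using that by (simp add: order_interval_def)
    have "(\<lambda>\<omega>. Y \<omega> - X\<^sub>0 \<omega>) \<in> ?D" using that X0(2) by (auto simp: order_interval_def)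
    then show ?thesis using normal \<theta>_diff[OF Y] by fastforce
  qed
  show "\<exists>P\<in>finite_penalty_probs M \<rho>\<^sub>1. \<exists>Q\<in>finite_penalty_probs M \<rho>\<^sub>2.
       \<forall>X. optimal_test M \<rho>\<^sub>1 \<rho>\<^sub>2 K\<^sub>1 K\<^sub>2 \<alpha> X \<longrightarrow>
         (\<exists>z::ennreal. \<exists>B\<in>borel_measurable M.
            (AE \<omega> in M. K\<^sub>1 \<omega> \<le> B \<omega> \<and> B \<omega> \<le> K\<^sub>2 \<omega>) \<and>
            (AE \<omega> in M. X \<omega> =
               K\<^sub>2 \<omega> * indicator (density_above M Q P z) \<omega> +
               B \<omega> * indicator (density_equal M Q P z) \<omega> +
               K\<^sub>1 \<omega> * indicator (density_below M Q P z) \<omega>))"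
  proof (intro bexI[OF _ P(1)] bexI[OF _ Q(1)] allI impI)
    fix X assume X: "optimal_test M \<rho>\<^sub>1 \<rho>\<^sub>2 K\<^sub>1 K\<^sub>2 \<alpha> X"
    then have XS: "X \<in> ?S" by (simp add: optimal_test_iff tests)
    then have X_int: "integrable M X" and X_bd: "AE \<omega> in M. K\<^sub>1 \<omega> \<le> X \<omega> \<and> X \<omega> \<le> K\<^sub>2 \<omega>"
      by (auto simp: order_interval_def)
    \<comment> \<open>the subgradients at \<open>X\<^sub>0\<close> show that \<open>X\<close> has no larger linearized cost than \<open>X\<^sub>0\<close>,
      so that \<open>X\<close> minimizes this cost as well\<close>
    have "a * (\<rho>\<^sub>1 X\<^sub>0 + (\<integral>\<omega>. X \<omega> - X\<^sub>0 \<omega> \<partial>P)) \<le> a * \<rho>\<^sub>1 X"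
      by (rule mult_left_mono[OF subgradientD[OF P(2) X_int] ab(1)])
    then have leP: "a * (\<integral>\<omega>. X \<omega> - X\<^sub>0 \<omega> \<partial>P) \<le> 0"
      using slack(1)[OF X] slack(1)[OF opt] by (simp add: distrib_left)
    have "?\<phi> X\<^sub>0 + (\<integral>\<omega>. (K\<^sub>2 \<omega> - X \<omega>) - (K\<^sub>2 \<omega> - X\<^sub>0 \<omega>) \<partial>Q) \<le> ?\<phi> X"
      using K(2) X_int by (intro subgradientD[OF Q(2)]) simp
    moreover have "(\<lambda>\<omega>. (K\<^sub>2 \<omega> - X \<omega>) - (K\<^sub>2 \<omega> - X\<^sub>0 \<omega>)) = (\<lambda>\<omega>. - (X \<omega> - X\<^sub>0 \<omega>))" by auto
    ultimately have "0 \<le> (\<integral>\<omega>. X \<omega> - X\<^sub>0 \<omega> \<partial>Q)"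
      using slack(2)[OF X] by (simp only: integral_minus)
    then have "0 \<le> b * (\<integral>\<omega>. X \<omega> - X\<^sub>0 \<omega> \<partial>Q)" using ab(2) by simp
    with leP have le: "(\<integral>\<omega>. \<theta> \<omega> * X \<omega> \<partial>M) \<le> (\<integral>\<omega>. \<theta> \<omega> * X\<^sub>0 \<omega> \<partial>M)"
      using \<theta>_diff[OF X_int] by simp
    have "AE \<omega> in M. (\<theta> \<omega> < 0 \<longrightarrow> X \<omega> = K\<^sub>2 \<omega>) \<and> (0 < \<theta> \<omega> \<longrightarrow> X \<omega> = K\<^sub>1 \<omega>)"
    proof (rule order_interval_minimizer_bang_bang[OF _ K X_int X_bd \<theta>_int])
      show "\<theta> \<in> borel_measurable M" unfolding \<theta>_def[abs_def] using G(1) H(1) by measurable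
      show "(\<integral>\<omega>. \<theta> \<omega> * X \<omega> \<partial>M) \<le> (\<integral>\<omega>. \<theta> \<omega> * Y \<omega> \<partial>M)"
        if "integrable M Y" "AE \<omega> in M. K\<^sub>1 \<omega> \<le> Y \<omega> \<and> Y \<omega> \<le> K\<^sub>2 \<omega>" for Y
        using order_trans[OF le X0_min] that by (simp add: order_interval_def)
    qed
    then have "AE \<omega> in M. X \<omega> =
        K\<^sub>2 \<omega> * indicator (density_above M Q P (if b = 0 then \<infinity> else ennreal (a / b))) \<omega> +
        X \<omega> * indicator (density_equal M Q P (if b = 0 then \<infinity> else ennreal (a / b))) \<omega> +
        K\<^sub>1 \<omega> * indicator (density_below M Q P (if b = 0 then \<infinity> else ennreal (a / b))) \<omega>"
      unfolding \<theta>_def by (rule bang_bang_imp_density_regions[OF ab G(2,3) H(2,3)])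
    with X_int X_bd show "\<exists>z::ennreal. \<exists>B\<in>borel_measurable M.
            (AE \<omega> in M. K\<^sub>1 \<omega> \<le> B \<omega> \<and> B \<omega> \<le> K\<^sub>2 \<omega>) \<and>
            (AE \<omega> in M. X \<omega> =
               K\<^sub>2 \<omega> * indicator (density_above M Q P z) \<omega> +
               B \<omega> * indicator (density_equal M Q P z) \<omega> +
               K\<^sub>1 \<omega> * indicator (density_below M Q P z) \<omega>)"
      by blast
  qed
qed

end
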